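(* Let $\Gamma$ be a countable strongly algebraically closed bipartite graph that is not isomorphic to the countable universal bipartite graph $B$. Then there exists a non-regular injective endomorphism $f$ of $B$ such that the bipartite subgraph of $B$ induced by the images of the vertices under $f$ is isomorphic to $\Gamma$ and such that the $\mathscr{D}$-class of $f$ in $\operatorname{End} B$ contains $2^{\aleph_0}$ $\mathscr{R}$-classes and $2^{\aleph_0}$ $\mathscr{L}$-classes.
   Context: A bipartite graph is a relational structure $(V,E,P)$ where $E$ is an irreflexive symmetric binary relation on $V$, $P=(V_0\times V_0)\cup(V_1\times V_1)$ for some partition $V=V_0\,\dot\cup\,V_1$, and $(u,v)\in E$ implies $(u,v)\notin P$; homomorphisms preserve $E$ and $P$, isomorphisms are bijections whose inverses are homomorphisms. A bipartite graph is strongly algebraically closed if for every finite set $A$ of pairwise $P$-related vertices there exist infinitely many vertices adjacent to every vertex of $A$. The countable universal bipartite graph $B$ is the Fraïssé limit of the finite bipartite graphs in this sense. The induced substructure on $U\subseteq V$ is $(U,E\cap(U\times U),P\cap(U\times U))$. Green's relations on $M=\operatorname{End} B$: $f\,\mathscr{L}\,g$ iff $Mf=Mg$; $f\,\mathscr{R}\,g$ iff $fM=gM$; $\mathscr{D}=\mathscr{L}\circ\mathscr{R}$. An element $f$ is regular if $fgf=f$ for some $g\in M$. *)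

theory Defs
  imports "HOL-Algebra.Coset" "HOL-Library.Countable_Set" "HOL-Library.Equipollence"
begin

record 'a bstruct =
  verts :: "'a set"
  Erel :: "('a \<times> 'a) set"
  Prel :: "('a \<times> 'a) set"

definition structure_wf :: "'a bstruct \<Rightarrow> bool" where
  "structure_wf G \<longleftrightarrow> Erel G \<subseteq> verts G \<times> verts G \<and> Prel G \<subseteq> verts G \<times> verts G"

definition hom_on :: "'a bstruct \<Rightarrow> 'b bstruct \<Rightarrow> ('a \<Rightarrow> 'b) \<Rightarrow> bool" where
  "hom_on G H f \<longleftrightarrow> f \<in> verts G \<rightarrow> verts H \<and>
     (\<forall>(u, v) \<in> Erel G. (f u, f v) \<in> Erel H) \<and>
     (\<forall>(u, v) \<in> Prel G. (f u, f v) \<in> Prel H)"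

definition iso_on :: "'a bstruct \<Rightarrow> 'b bstruct \<Rightarrow> ('a \<Rightarrow> 'b) \<Rightarrow> bool" where
  "iso_on G H f \<longleftrightarrow> bij_betw f (verts G) (verts H) \<and>
     hom_on G H f \<and> hom_on H G (inv_into (verts G) f)"

definition isomorphic :: "'a bstruct \<Rightarrow> 'b bstruct \<Rightarrow> bool" where
  "isomorphic G H \<longleftrightarrow> (\<exists>f. iso_on G H f)"

definition induced :: "'a bstruct \<Rightarrow> 'a set \<Rightarrow> 'a bstruct" where
  "induced G U = \<lparr>verts = U, Erel = Erel G \<inter> (U \<times> U), Prel = Prel G \<inter> (U \<times> U)\<rparr>"

text \<open>One of the two parts may be empty: otherwise the class of finite bipartite graphs would
  not be closed under induced substructures.\<close>

definition bipartite_graph :: "'a bstruct \<Rightarrow> bool" where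
  "bipartite_graph G \<longleftrightarrow>
     Erel G \<subseteq> verts G \<times> verts G \<and> irrefl (Erel G) \<and> sym (Erel G) \<and>
     (\<exists>V0 V1. V0 \<union> V1 = verts G \<and> V0 \<inter> V1 = {} \<and> Prel G = (V0 \<times> V0) \<union> (V1 \<times> V1)) \<and>
     (\<forall>u v. (u, v) \<in> Erel G \<longrightarrow> (u, v) \<notin> Prel G)"

definition strongly_algebraically_closed :: "'a bstruct \<Rightarrow> bool" where
  "strongly_algebraically_closed G \<longleftrightarrow>
     (\<forall>A \<subseteq> verts G. finite A \<and> (\<forall>a\<in>A. \<forall>b\<in>A. (a, b) \<in> Prel G) \<longrightarrow>
        infinite {v \<in> verts G. \<forall>a\<in>A. (a, v) \<in> Erel G})"

text \<open>Every finite structure has an isomorphic copy with vertices in \<^typ>\<open>nat\<close>, so the age, and the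
  class of finite structures it is compared with, are given by such copies.\<close>

definition age :: "'a bstruct \<Rightarrow> nat bstruct set" where
  "age G = {H. structure_wf H \<and> (\<exists>U \<subseteq> verts G. finite U \<and> isomorphic H (induced G U))}"

definition homogeneous :: "'a bstruct \<Rightarrow> bool" where
  "homogeneous G \<longleftrightarrow>
     (\<forall>U \<subseteq> verts G. \<forall>W \<subseteq> verts G. \<forall>f. finite U \<and> finite W \<and> iso_on (induced G U) (induced G W) f \<longrightarrow>
        (\<exists>g. iso_on G G g \<and> (\<forall>x\<in>U. g x = f x)))"

definition Fraisse_limit :: "nat bstruct set \<Rightarrow> 'a bstruct \<Rightarrow> bool" where
  "Fraisse_limit K G \<longleftrightarrow> structure_wf G \<and> countable (verts G) \<and> age G = K \<and> homogeneous G"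

definition finite_bipartite_graphs :: "nat bstruct set" where
  "finite_bipartite_graphs = {H. finite (verts H) \<and> bipartite_graph H}"

definition universal_bipartite_graph :: "'a bstruct \<Rightarrow> bool" where
  "universal_bipartite_graph B \<longleftrightarrow> bipartite_graph B \<and> Fraisse_limit finite_bipartite_graphs B"

text \<open>Endomorphisms are extensional functions, so that distinct elements of the carrier are
  distinct as maps on the vertices.\<close>

definition End_monoid :: "'a bstruct \<Rightarrow> ('a \<Rightarrow> 'a) monoid" where
  "End_monoid G = \<lparr>carrier = {f \<in> extensional (verts G). hom_on G G f},
     mult = compose (verts G), one = (\<lambda>x \<in> verts G. x)\<rparr>"

definition green_L :: "('a, 'm) monoid_scheme \<Rightarrow> ('a \<times> 'a) set" where
  "green_L M = {(f, g). f \<in> carrier M \<and> g \<in> carrier M \<and>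
     carrier M #>\<^bsub>M\<^esub> f = carrier M #>\<^bsub>M\<^esub> g}"

definition green_R :: "('a, 'm) monoid_scheme \<Rightarrow> ('a \<times> 'a) set" where
  "green_R M = {(f, g). f \<in> carrier M \<and> g \<in> carrier M \<and>
     f <#\<^bsub>M\<^esub> carrier M = g <#\<^bsub>M\<^esub> carrier M}"

definition green_D :: "('a, 'm) monoid_scheme \<Rightarrow> ('a \<times> 'a) set" where
  "green_D M = green_L M O green_R M"

definition regular_element :: "('a, 'm) monoid_scheme \<Rightarrow> 'a \<Rightarrow> bool" where
  "regular_element M f \<longleftrightarrow> f \<in> carrier M \<and> (\<exists>g \<in> carrier M. f \<otimes>\<^bsub>M\<^esub> g \<otimes>\<^bsub>M\<^esub> f = f)"

lemma monoid_End_monoid: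
  assumes "structure_wf G"
  shows "monoid (End_monoid G)"
proof (rule monoidI)
  fix f g assume f: "f \<in> carrier (End_monoid G)" and g: "g \<in> carrier (End_monoid G)"
  have Eh: "\<And>u v. (u, v) \<in> Erel G \<Longrightarrow> (h u, h v) \<in> Erel G"
    and Ph: "\<And>u v. (u, v) \<in> Prel G \<Longrightarrow> (h u, h v) \<in> Prel G"
    if "h \<in> carrier (End_monoid G)" for h
    using that by (auto simp: End_monoid_def hom_on_def)
  have "hom_on G G (compose (verts G) f g)"
    unfolding hom_on_def
  proof (intro conjI ballI)
    show "compose (verts G) f g \<in> verts G \<rightarrow> verts G"
      using f g by (intro funcset_compose[where B = "verts G"]) (simp_all add: End_monoid_def hom_on_def)
  next
    fix e assume e: "e \<in> Erel G"
    obtain u v where uv: "e = (u, v)" by fastforce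
    then have "u \<in> verts G" "v \<in> verts G" using e assms by (auto simp: structure_wf_def)
    moreover have "(f (g u), f (g v)) \<in> Erel G"
      using Eh[OF f] Eh[OF g] e uv by blast
    ultimately show "case e of (u, v) \<Rightarrow> (compose (verts G) f g u, compose (verts G) f g v) \<in> Erel G"
      by (simp add: uv compose_eq)
  next
    fix e assume e: "e \<in> Prel G"
    obtain u v where uv: "e = (u, v)" by fastforce
    then have "u \<in> verts G" "v \<in> verts G" using e assms by (auto simp: structure_wf_def)
    moreover have "(f (g u), f (g v)) \<in> Prel G"
      using Ph[OF f] Ph[OF g] e uv by blast
    ultimately show "case e of (u, v) \<Rightarrow> (compose (verts G) f g u, compose (verts G) f g v) \<in> Prel G"
      by (simp add: uv compose_eq)
  qed
  then show "f \<otimes>\<^bsub>End_monoid G\<^esub> g \<in> carrier (End_monoid G)"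
    by (simp add: End_monoid_def)
next
  show "\<one>\<^bsub>End_monoid G\<^esub> \<in> carrier (End_monoid G)"
    using assms by (auto simp: End_monoid_def hom_on_def structure_wf_def)
next
  fix f g h
  assume "h \<in> carrier (End_monoid G)"
  then have "h \<in> verts G \<rightarrow> verts G" by (simp add: End_monoid_def hom_on_def)
  from compose_assoc[OF this, of f g, symmetric]
  show "f \<otimes>\<^bsub>End_monoid G\<^esub> g \<otimes>\<^bsub>End_monoid G\<^esub> h = f \<otimes>\<^bsub>End_monoid G\<^esub> (g \<otimes>\<^bsub>End_monoid G\<^esub> h)"
    by (simp add: End_monoid_def)
next
  fix f assume "f \<in> carrier (End_monoid G)"
  then have "f \<in> verts G \<rightarrow> verts G" "f \<in> extensional (verts G)"
    by (simp_all add: End_monoid_def hom_on_def)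
  then show "\<one>\<^bsub>End_monoid G\<^esub> \<otimes>\<^bsub>End_monoid G\<^esub> f = f" "f \<otimes>\<^bsub>End_monoid G\<^esub> \<one>\<^bsub>End_monoid G\<^esub> = f"
    by (simp_all add: End_monoid_def Id_compose compose_Id)
qed

end

theory Submission
  imports Defs
begin

text \<open>
  Back-and-forth gives a bijective homomorphism \<open>\<phi>\<close> from \<open>B\<close> onto \<open>\<Gamma>\<close>, and every countably infinite
  bipartite graph \<open>C\<close> embeds into \<open>B\<close> so sparsely that each vertex outside the image has only
  finitely many neighbours in the image; hence side-preserving homomorphisms from \<open>C\<close> to \<open>B\<close> extend
  to endomorphisms of \<open>B\<close>. If \<open>\<psi>\<close> embeds \<open>\<Gamma>\<close> into \<open>B\<close>, then \<open>f = \<psi>\<phi>\<close> is injective; regularity would give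
  it a left inverse and turn \<open>\<phi>\<close> into an isomorphism.

  For the \<open>\<R>\<close>-classes take for \<open>C\<close> the graph \<open>\<Gamma>\<close> with every vertex doubled to a pair of twins. Every choice
  of one twin per vertex is a copy of \<open>\<Gamma>\<close> in \<open>B\<close>; identifying twins shows that the resulting maps
  are \<open>\<L>\<close>-related, while different choices have different images. For the \<open>\<L>\<close>-classes take for \<open>C\<close> the
  graph \<open>B\<close> with countably many isolated vertices added. Retractions of \<open>C\<close> onto \<open>B\<close> that send these
  to \<open>b0\<close> or \<open>b1\<close> according to a set of naturals extend to split surjections \<open>k\<close> of \<open>B\<close>; the maps \<open>fk\<close> are
  \<open>\<R>\<close>-related to \<open>f\<close> and have different kernels.
\<close>

section \<open>Bipartite graphs with a side function\<close>

text \<open>\<open>Prel\<close> is traded for a function naming the side of each vertex. A \<open>side_hom\<close> must respect the names,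
  whereas an arbitrary homomorphism may also swap or merge the sides.\<close>

definition sided :: "'a bstruct \<Rightarrow> ('a \<Rightarrow> bool) \<Rightarrow> bool" where
  "sided G s \<longleftrightarrow> Erel G \<subseteq> verts G \<times> verts G \<and> sym (Erel G) \<and>
     Prel G = {(u, v). u \<in> verts G \<and> v \<in> verts G \<and> s u = s v} \<and>
     (\<forall>u v. (u, v) \<in> Erel G \<longrightarrow> s u \<noteq> s v)"

definition side_hom ::
    "'a bstruct \<Rightarrow> ('a \<Rightarrow> bool) \<Rightarrow> 'b bstruct \<Rightarrow> ('b \<Rightarrow> bool) \<Rightarrow> ('a \<Rightarrow> 'b) \<Rightarrow> bool" where
  "side_hom G s H t f \<longleftrightarrow> f \<in> verts G \<rightarrow> verts H \<and>
     (\<forall>u v. (u, v) \<in> Erel G \<longrightarrow> (f u, f v) \<in> Erel H) \<and> (\<forall>u \<in> verts G. t (f u) = s u)"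

text \<open>Strong algebraic closure as the constructions use it: the side of the new vertex is
  prescribed, which matters when \<open>A\<close> is empty, and \<open>Z\<close> keeps it
  fresh.\<close>

definition side_closed :: "'a bstruct \<Rightarrow> ('a \<Rightarrow> bool) \<Rightarrow> bool" where
  "side_closed G s \<longleftrightarrow> (\<forall>A Z t. finite A \<and> finite Z \<and> A \<subseteq> verts G \<and> (\<forall>a\<in>A. s a \<noteq> t) \<longrightarrow>
     (\<exists>v \<in> verts G. v \<notin> Z \<and> s v = t \<and> (\<forall>a\<in>A. (a, v) \<in> Erel G)))"

text \<open>The one-point extension axiom of the random bipartite graph. In a sided graph
  \<open>Y\<close> forbids edges on the side opposite to \<open>t\<close> and keeps the new vertex
  fresh on side \<open>t\<close>.\<close>

definition extension_property :: "'a bstruct \<Rightarrow> ('a \<Rightarrow> bool) \<Rightarrow> bool" where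
  "extension_property G s \<longleftrightarrow> (\<forall>X Y t. finite X \<and> finite Y \<and> X \<subseteq> verts G \<and> Y \<subseteq> verts G \<and>
     X \<inter> Y = {} \<and> (\<forall>x\<in>X. s x \<noteq> t) \<longrightarrow>
     (\<exists>v \<in> verts G. v \<notin> X \<and> v \<notin> Y \<and> s v = t \<and>
        (\<forall>x\<in>X. (x, v) \<in> Erel G) \<and> (\<forall>y\<in>Y. (y, v) \<notin> Erel G)))"

lemma side_closedD:
  assumes "side_closed G s" "finite A" "finite Z" "A \<subseteq> verts G" "\<And>a. a \<in> A \<Longrightarrow> s a \<noteq> t"
  obtains v where "v \<in> verts G" "v \<notin> Z" "s v = t" "\<And>a. a \<in> A \<Longrightarrow> (a, v) \<in> Erel G"
  using assms(1)[unfolded side_closed_def, rule_format, of A Z t] assms(2-) by auto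

lemma extension_propertyD:
  assumes "extension_property G s" "finite X" "finite Y" "X \<subseteq> verts G" "Y \<subseteq> verts G"
    "X \<inter> Y = {}" "\<And>x. x \<in> X \<Longrightarrow> s x \<noteq> t"
  obtains v where "v \<in> verts G" "v \<notin> X" "v \<notin> Y" "s v = t" "\<And>x. x \<in> X \<Longrightarrow> (x, v) \<in> Erel G"
    "\<And>y. y \<in> Y \<Longrightarrow> (y, v) \<notin> Erel G"
  using assms(1)[unfolded extension_property_def, rule_format, of X Y t] assms(2-) by auto

text \<open>The vertices to be avoided, as far as they lie in the graph and outside
  \<open>A\<close>, are put into \<open>Y\<close>; members of \<open>A\<close> are avoided in any
  case.\<close>

lemma extension_property_imp_side_closed:
  fixes G :: "'a bstruct"
  assumes "extension_property G s"
  shows "side_closed G s"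
  unfolding side_closed_def
proof (intro allI impI, elim conjE)
  fix A Z :: "'a set" and t
  assume A: "finite A" "finite Z" "A \<subseteq> verts G" "\<forall>a\<in>A. s a \<noteq> t"
  obtain v where "v \<in> verts G" "v \<notin> A" "v \<notin> (Z \<inter> verts G) - A" "s v = t" "\<And>x. x \<in> A \<Longrightarrow> (x, v) \<in> Erel G"
    using extension_propertyD[OF assms, of A "(Z \<inter> verts G) - A" t] A by auto
  then show "\<exists>v \<in> verts G. v \<notin> Z \<and> s v = t \<and> (\<forall>a\<in>A. (a, v) \<in> Erel G)" by auto
qed

lemma side_closed_infinite:
  assumes "side_closed G s"
  shows "infinite (verts G)"
  using side_closedD[OF assms, of "{}" "verts G"] by auto

text \<open>Membership in \<open>V0\<close> names the side. Conversely, irreflexivity follows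
  because an edge joins different sides.\<close>

lemma bipartite_graph_iff_sided: "bipartite_graph G \<longleftrightarrow> (\<exists>s. sided G s)"
proof
  assume G: "bipartite_graph G"
  then obtain V0 V1 where V: "V0 \<union> V1 = verts G" "V0 \<inter> V1 = {}" "Prel G = (V0 \<times> V0) \<union> (V1 \<times> V1)"
    unfolding bipartite_graph_def by blast
  have E: "Erel G \<subseteq> verts G \<times> verts G" "sym (Erel G)" "\<forall>u v. (u, v) \<in> Erel G \<longrightarrow> (u, v) \<notin> Prel G"
    using G by (simp_all add: bipartite_graph_def)
  have P: "Prel G = {(u, v). u \<in> verts G \<and> v \<in> verts G \<and> (u \<in> V0) = (v \<in> V0)}"
    unfolding V(3) V(1)[symmetric] using V(2) by auto
  have "sided G (\<lambda>v. v \<in> V0)"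
    unfolding sided_def using E P by auto
  then show "\<exists>s. sided G s" by blast
next
  assume "\<exists>s. sided G s"
  then obtain s where s: "sided G s" ..
  have "{v \<in> verts G. s v} \<union> {v \<in> verts G. \<not> s v} = verts G \<and>
      {v \<in> verts G. s v} \<inter> {v \<in> verts G. \<not> s v} = {} \<and>
      Prel G = ({v \<in> verts G. s v} \<times> {v \<in> verts G. s v}) \<union> ({v \<in> verts G. \<not> s v} \<times> {v \<in> verts G. \<not> s v})"
    using s unfolding sided_def by auto
  then have "\<exists>V0 V1. V0 \<union> V1 = verts G \<and> V0 \<inter> V1 = {} \<and> Prel G = (V0 \<times> V0) \<union> (V1 \<times> V1)"
    by blast
  then show "bipartite_graph G"
    using s unfolding bipartite_graph_def sided_def irrefl_def by auto
qed

text \<open>Enlarging \<open>A\<close> by a vertex \<open>w\<close> off side \<open>t\<close> forces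
  every common neighbour onto side \<open>t\<close>, even if \<open>A\<close> is empty. There are
  infinitely many of them, so one lies outside \<open>Z\<close>.\<close>

lemma strongly_algebraically_closed_imp_side_closed:
  fixes G :: "'a bstruct"
  assumes s: "sided G s" and G: "strongly_algebraically_closed G"
  shows "side_closed G s"
  unfolding side_closed_def
proof (intro allI impI, elim conjE)
  fix A Z :: "'a set" and t
  assume A: "finite A" "finite Z" "A \<subseteq> verts G" "\<forall>a\<in>A. s a \<noteq> t"
  have inf: "infinite {v \<in> verts G. \<forall>a\<in>A. (a, v) \<in> Erel G}"
    if "A \<subseteq> verts G" "finite A" "\<And>a b. a \<in> A \<Longrightarrow> b \<in> A \<Longrightarrow> s a = s b" for A
  proof -
    have "\<forall>a\<in>A. \<forall>b\<in>A. (a, b) \<in> Prel G"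
    proof (intro ballI)
      fix a b assume "a \<in> A" "b \<in> A"
      then show "(a, b) \<in> Prel G" using that(3)[of a b] that(1) s by (auto simp: sided_def)
    qed
    then show ?thesis
      using G that(1,2) unfolding strongly_algebraically_closed_def by blast
  qed
  have ex: "\<exists>v \<in> verts G. \<forall>a\<in>A. (a, v) \<in> Erel G"
    if "A \<subseteq> verts G" "finite A" "\<And>a b. a \<in> A \<Longrightarrow> b \<in> A \<Longrightarrow> s a = s b" for A
    using infinite_imp_nonempty[OF inf[OF that]] by blast
  \<comment> \<open>A common neighbour of the empty set is just a vertex; it and one of its
    neighbours lie on different sides.\<close>
  have "\<exists>w \<in> verts G. s w \<noteq> t"
  proof -
    obtain x where x: "x \<in> verts G" using ex[of "{}"] by auto
    then obtain y where y: "y \<in> verts G" "(x, y) \<in> Erel G" using ex[of "{x}"] by auto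
    have "s x \<noteq> s y" using y s by (auto simp: sided_def)
    then show ?thesis using x y by blast
  qed
  then obtain w where w: "w \<in> verts G" "s w \<noteq> t" by blast
  have "infinite {v \<in> verts G. \<forall>a\<in>insert w A. (a, v) \<in> Erel G}"
    by (rule inf) (use A w in auto)
  then have "infinite ({v \<in> verts G. \<forall>a\<in>insert w A. (a, v) \<in> Erel G} - Z)"
    using A by simp
  then obtain v where v: "v \<in> verts G" "v \<notin> Z" "\<forall>a\<in>insert w A. (a, v) \<in> Erel G"
    using infinite_imp_nonempty by blast
  then have "s w \<noteq> s v" using s by (auto simp: sided_def)
  then show "\<exists>v \<in> verts G. v \<notin> Z \<and> s v = t \<and> (\<forall>a\<in>A. (a, v) \<in> Erel G)"
    using v w by blast
qed

lemma side_hom_imp_hom_on: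
  assumes "sided G s" "sided H t" "side_hom G s H t f"
  shows "hom_on G H f"
  using assms unfolding hom_on_def side_hom_def sided_def by auto

lemma side_hom_comp:
  assumes "side_hom G s H t f" "side_hom H t K u g"
  shows "side_hom G s K u (g \<circ> f)"
  using assms unfolding side_hom_def by auto

text \<open>Well-formedness puts both ends of a related pair into the vertex set, where
  \<open>f\<close> and its inverse cancel; so the inverse is a homomorphism exactly if
  \<open>f\<close> reflects both relations.\<close>

lemma iso_on_iff:
  assumes "structure_wf G" "structure_wf H"
  shows "iso_on G H f \<longleftrightarrow> bij_betw f (verts G) (verts H) \<and>
    (\<forall>u \<in> verts G. \<forall>v \<in> verts G. ((f u, f v) \<in> Erel H \<longleftrightarrow> (u, v) \<in> Erel G) \<and>
       ((f u, f v) \<in> Prel H \<longleftrightarrow> (u, v) \<in> Prel G))" (is "_ \<longleftrightarrow> ?R")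
proof
  assume "iso_on G H f"
  then have b: "bij_betw f (verts G) (verts H)" and f: "hom_on G H f"
    and i: "hom_on H G (inv_into (verts G) f)" unfolding iso_on_def by auto
  have "inv_into (verts G) f (f u) = u" if "u \<in> verts G" for u
    using b that by (simp add: bij_betw_def)
  then show ?R
    using b f i unfolding hom_on_def by fastforce
next
  assume R: ?R
  then have b: "bij_betw f (verts G) (verts H)" by blast
  have i: "inv_into (verts G) f v \<in> verts G" "f (inv_into (verts G) f v) = v" if "v \<in> verts H" for v
    using b that by (auto simp: bij_betw_def inv_into_into f_inv_into_f)
  have "hom_on G H f"
    using R assms unfolding hom_on_def structure_wf_def by (auto simp: bij_betw_def)
  moreover have "hom_on H G (inv_into (verts G) f)"
    unfolding hom_on_def
  proof (intro conjI)
    show "inv_into (verts G) f \<in> verts H \<rightarrow> verts G" using i by auto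
    show "\<forall>(u, v)\<in>Erel H. (inv_into (verts G) f u, inv_into (verts G) f v) \<in> Erel G"
    proof clarify
      fix u v assume e: "(u, v) \<in> Erel H"
      then have "u \<in> verts H" "v \<in> verts H" using assms by (auto simp: structure_wf_def)
      then show "(inv_into (verts G) f u, inv_into (verts G) f v) \<in> Erel G"
        using R i e by metis
    qed
    show "\<forall>(u, v)\<in>Prel H. (inv_into (verts G) f u, inv_into (verts G) f v) \<in> Prel G"
    proof clarify
      fix u v assume e: "(u, v) \<in> Prel H"
      then have "u \<in> verts H" "v \<in> verts H" using assms by (auto simp: structure_wf_def)
      then show "(inv_into (verts G) f u, inv_into (verts G) f v) \<in> Prel G"
        using R i e by metis
    qed
  qed
  ultimately show "iso_on G H f" using b by (simp add: iso_on_def)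
qed

lemma sided_structure_wf: "sided G s \<Longrightarrow> structure_wf G"
  by (auto simp: sided_def structure_wf_def)

lemma structure_wf_induced: "structure_wf (induced G U)"
  by (auto simp: structure_wf_def induced_def)

lemma induced_simps [simp]:
  "verts (induced G U) = U" "Erel (induced G U) = Erel G \<inter> (U \<times> U)"
  "Prel (induced G U) = Prel G \<inter> (U \<times> U)"
  by (simp_all add: induced_def)

section \<open>The extension property of the universal graph\<close>

text \<open>A single edge belongs to the age, and the two ends of its copy lie on different
  sides.\<close>

lemma universal_both_sides_nonempty:
  assumes "universal_bipartite_graph B" "sided B s"
  obtains u v where "u \<in> verts B" "v \<in> verts B" "s u" "\<not> s v"
proof -
  define H :: "nat bstruct" where
    "H = \<lparr>verts = {0, 1}, Erel = {(0, 1), (1, 0)}, Prel = {(0, 0), (1, 1)}\<rparr>"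
  have "sided H (\<lambda>v. v = 0)"
    unfolding sided_def H_def sym_def by auto
  then have "H \<in> finite_bipartite_graphs"
    unfolding finite_bipartite_graphs_def bipartite_graph_iff_sided by (auto simp: H_def)
  then have "H \<in> age B"
    using assms(1) unfolding universal_bipartite_graph_def Fraisse_limit_def by simp
  then obtain U q where U: "U \<subseteq> verts B" and q: "hom_on H (induced B U) q"
    unfolding age_def isomorphic_def iso_on_def by auto
  then have "(q 0, q 1) \<in> Erel B"
    unfolding hom_on_def H_def by auto
  then have "q 0 \<in> verts B" "q 1 \<in> verts B" "s (q 0) \<noteq> s (q 1)"
    using assms(2) unfolding sided_def by auto
  then show thesis using that by (cases "s (q 0)") auto
qed

text \<open>The finite subgraph on \<open>F\<close> with the required vertex added abstractly is in
  the age. Homogeneity extends the map from \<open>F\<close> to its copy to an automorphism, and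
  pulling the added vertex back along it gives the vertex sought.\<close>

lemma universal_extension_property:
  assumes B: "universal_bipartite_graph B" and s: "sided B s"
  shows "extension_property B s"
  unfolding extension_property_def
proof (intro allI impI, elim conjE)
  fix X Y t
  assume X: "finite X" "finite Y" "X \<subseteq> verts B" "Y \<subseteq> verts B" "X \<inter> Y = {}" "\<forall>x\<in>X. s x \<noteq> t"
  \<comment> \<open>\<open>Prel\<close> only tells whether two vertices share a side. These vertices
    keep \<open>F\<close> nonempty, so that comparison with them fixes the side of the new
    vertex.\<close>
  obtain u0 u1 where u: "u0 \<in> verts B" "u1 \<in> verts B" "s u0" "\<not> s u1"
    using universal_both_sides_nonempty[OF B s] by blast
  define F where "F = X \<union> Y \<union> {u0, u1}"
  have F: "finite F" "F \<subseteq> verts B" using X u by (auto simp: F_def)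
  \<comment> \<open>Members of the age live on naturals: \<open>F\<close> is numbered by
    \<open>0, ..., n - 1\<close>, and \<open>n\<close> itself is the added vertex, joined exactly to
    \<open>X\<close>.\<close>
  define n where "n = card F"
  obtain h where h: "bij_betw h F {0..<n}" 
    using ex_bij_betw_finite_nat[OF F(1)] by (auto simp: n_def)
  define k where "k = inv_into F h"
  have k: "k i \<in> F" "h (k i) = i" if "i < n" for i
    using h that by (auto simp: k_def bij_betw_def inv_into_into f_inv_into_f)
  have kh: "k (h x) = x" "h x < n" if "x \<in> F" for x
    using h that by (auto simp: k_def bij_betw_def)
  define \<sigma> where "\<sigma> i = (if i < n then s (k i) else t)" for i
  define E where "E = {(i, j). i < n \<and> j < n \<and> (k i, k j) \<in> Erel B} \<union>
     {(i, j). i < n \<and> j = n \<and> k i \<in> X} \<union> {(i, j). i = n \<and> j < n \<and> k j \<in> X}"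
  define H where "H = \<lparr>verts = {..n}, Erel = E, Prel = {(i, j). i \<le> n \<and> j \<le> n \<and> \<sigma> i = \<sigma> j}\<rparr>"
  have sE: "sym (Erel B)" "\<And>u v. (u, v) \<in> Erel B \<Longrightarrow> s u \<noteq> s v"
    "Prel B = {(u, v). u \<in> verts B \<and> v \<in> verts B \<and> s u = s v}"
    using s by (auto simp: sided_def)
  have sH: "sided H \<sigma>"
    unfolding sided_def
  proof (intro conjI)
    show "sym (Erel H)" using sE(1) by (auto simp: H_def E_def sym_def)
    show "\<forall>u v. (u, v) \<in> Erel H \<longrightarrow> \<sigma> u \<noteq> \<sigma> v"
      using sE(2) X(6) by (auto simp: H_def E_def \<sigma>_def)
  qed (auto simp: H_def E_def)
  then have "H \<in> finite_bipartite_graphs"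
    unfolding finite_bipartite_graphs_def bipartite_graph_iff_sided by (auto simp: H_def)
  then have "H \<in> age B"
    using B unfolding universal_bipartite_graph_def Fraisse_limit_def by simp
  then obtain U q where U: "U \<subseteq> verts B" and q: "iso_on H (induced B U) q"
    unfolding age_def isomorphic_def by auto
  have qb: "bij_betw q {..n} U"
    and qE: "\<And>i j. i \<le> n \<Longrightarrow> j \<le> n \<Longrightarrow> (q i, q j) \<in> Erel B \<longleftrightarrow> (i, j) \<in> E"
    and qP: "\<And>i j. i \<le> n \<Longrightarrow> j \<le> n \<Longrightarrow> (q i, q j) \<in> Prel B \<longleftrightarrow> \<sigma> i = \<sigma> j"
    using q unfolding iso_on_iff[OF sided_structure_wf[OF sH] structure_wf_induced]
    by (auto simp: H_def bij_betw_def)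
  define W where "W = (q \<circ> h) ` F"
  have hF: "h ` F \<subseteq> {..n}" using kh(2) by fastforce
  then have "q ` h ` F \<subseteq> U" using qb by (auto simp: bij_betw_def)
  then have W: "W \<subseteq> U" "finite W"
    using F(1) by (auto simp: W_def)
  have inj: "inj_on (q \<circ> h) F"
  proof (rule comp_inj_on)
    show "inj_on h F" using h by (simp add: bij_betw_def)
    show "inj_on q (h ` F)" using qb hF by (meson bij_betw_def inj_on_subset)
  qed
  have "iso_on (induced B F) (induced B W) (q \<circ> h)"
    unfolding iso_on_iff[OF structure_wf_induced structure_wf_induced]
  proof (intro conjI ballI)
    show "bij_betw (q \<circ> h) (verts (induced B F)) (verts (induced B W))"
      using inj by (simp add: bij_betw_def W_def)
    fix x y assume "x \<in> verts (induced B F)" "y \<in> verts (induced B F)"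
    then have xy: "x \<in> F" "y \<in> F" by auto
    then have m: "(q \<circ> h) x \<in> W" "(q \<circ> h) y \<in> W" by (auto simp: W_def)
    have "(q (h x), q (h y)) \<in> Erel B \<longleftrightarrow> (x, y) \<in> Erel B"
      using qE[of "h x" "h y"] kh[OF xy(1)] kh[OF xy(2)] by (auto simp: E_def)
    then show "((q \<circ> h) x, (q \<circ> h) y) \<in> Erel (induced B W) \<longleftrightarrow> (x, y) \<in> Erel (induced B F)"
      using m xy by simp
    have "(q (h x), q (h y)) \<in> Prel B \<longleftrightarrow> (x, y) \<in> Prel B"
      using qP[of "h x" "h y"] kh[OF xy(1)] kh[OF xy(2)] xy F(2) by (auto simp: \<sigma>_def sE(3))
    then show "((q \<circ> h) x, (q \<circ> h) y) \<in> Prel (induced B W) \<longleftrightarrow> (x, y) \<in> Prel (induced B F)"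
      using m xy by simp
  qed
  then obtain g where g: "iso_on B B g" "\<And>x. x \<in> F \<Longrightarrow> g x = q (h x)"
    using B F W U unfolding universal_bipartite_graph_def Fraisse_limit_def homogeneous_def
    by (metis (no_types, lifting) comp_apply order_trans)
  have gb: "bij_betw g (verts B) (verts B)"
    and gE: "\<And>u v. u \<in> verts B \<Longrightarrow> v \<in> verts B \<Longrightarrow> (g u, g v) \<in> Erel B \<longleftrightarrow> (u, v) \<in> Erel B"
    and gP: "\<And>u v. u \<in> verts B \<Longrightarrow> v \<in> verts B \<Longrightarrow> (g u, g v) \<in> Prel B \<longleftrightarrow> (u, v) \<in> Prel B"
    using g(1) sided_structure_wf[OF s] by (auto simp: iso_on_iff)
  \<comment> \<open>The copy of the added vertex is pulled back along the automorphism
    \<open>g\<close>.\<close>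
  have "q n \<in> verts B" using qb U by (auto simp: bij_betw_def)
  then obtain v where v: "v \<in> verts B" "g v = q n"
    using gb unfolding bij_betw_def by (metis imageE)
  have vE: "(x, v) \<in> Erel B \<longleftrightarrow> x \<in> X" if "x \<in> F" for x
    using gE[of x v] qE[of "h x" n] g(2)[OF that] kh[OF that] v that F(2) by (auto simp: E_def)
  have vP: "s x = s v \<longleftrightarrow> s x = t" if "x \<in> F" for x
    using gP[of x v] qP[of "h x" n] g(2)[OF that] kh[OF that] v that F(2) by (auto simp: \<sigma>_def sE(3))
  have "s v = t" using vP[of u0] vP[of u1] u by (auto simp: F_def)
  moreover have "v \<notin> F"
  proof
    assume vF: "v \<in> F"
    then have "q (h v) = q n" using g(2) v by simp
    then have "h v = n" using qb kh(2)[OF vF] by (auto simp: bij_betw_def inj_on_def)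
    then show False using kh(2)[OF vF] by simp
  qed
  ultimately show "\<exists>v \<in> verts B. v \<notin> X \<and> v \<notin> Y \<and> s v = t \<and>
        (\<forall>x\<in>X. (x, v) \<in> Erel B) \<and> (\<forall>y\<in>Y. (y, v) \<notin> Erel B)"
    using v(1) vE X(5) by (auto simp: F_def)
qed

section \<open>Embeddings from which homomorphisms extend\<close>

lemma sparse_embedding:
  fixes c :: "nat \<Rightarrow> 'c" and b :: "nat \<Rightarrow> 'b"
  assumes C: "sided C sC" and B: "sided B s" "extension_property B s"
    and c: "bij_betw c UNIV (verts C)" and b: "bij_betw b UNIV (verts B)"
  obtains e where "side_hom C sC B s e" "inj_on e (verts C)"
    "\<And>u v. u \<in> verts C \<Longrightarrow> v \<in> verts C \<Longrightarrow> (e u, e v) \<in> Erel B \<longleftrightarrow> (u, v) \<in> Erel C"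
    "\<And>v. v \<in> verts B - e ` verts C \<Longrightarrow> finite {u \<in> verts C. (e u, v) \<in> Erel B}"
proof -
  \<comment> \<open>The image of \<open>c n\<close> avoids the neighbourhood of every \<open>b m\<close>, \<open>m \<le> n\<close>, not yet used as an image,
    so an unused \<open>b m\<close> is adjacent only to images of \<open>c 0, \<dots>, c (m - 1)\<close>.\<close>
  define P where "P f n r \<longleftrightarrow> r \<in> verts B \<and> s r = sC (c n) \<and> r \<notin> b ` {..n} \<and>
     (\<forall>i<n. r \<noteq> f i \<and> ((f i, r) \<in> Erel B \<longleftrightarrow> (c i, c n) \<in> Erel C)) \<and>
     (\<forall>m\<le>n. b m \<notin> f ` {..<n} \<longrightarrow> (b m, r) \<notin> Erel B)" for f n r
  have CE: "sym (Erel C)" "\<And>u v. (u, v) \<in> Erel C \<Longrightarrow> sC u \<noteq> sC v"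
    "Erel C \<subseteq> verts C \<times> verts C" using C by (auto simp: sided_def)
  have BE: "sym (Erel B)" "\<And>u v. (u, v) \<in> Erel B \<Longrightarrow> s u \<noteq> s v"
    using B by (auto simp: sided_def)
  have "\<exists>f. \<forall>n. P f n (f n)"
  \<comment> \<open>Two things are due: \<open>P f n r\<close> depends on \<open>f\<close> only
    below \<open>n\<close>, and a value exists once all earlier ones are correct.\<close>
  proof (rule dependent_wellorder_choice)
    fix r and f g :: "nat \<Rightarrow> 'b" and x :: nat
    assume eq: "\<And>y. y < x \<Longrightarrow> f y = g y"
    have "f ` {..<x} = g ` {..<x}" by (rule image_cong) (auto simp: eq)
    then show "P f x r = P g x r" using eq by (auto simp: P_def)
  next
    fix n :: nat and f :: "nat \<Rightarrow> 'b"
    assume IH: "\<And>y. y < n \<Longrightarrow> P f y (f y)"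
    have inj: "f i \<noteq> f j" if "i < n" "j < n" "i \<noteq> j" for i j
      using that IH[of i] IH[of j] by (cases "i < j") (auto simp: P_def)
    \<comment> \<open>\<open>X\<close> holds the images of earlier neighbours of \<open>c n\<close>.
      All other earlier images, and all of \<open>b 0, ..., b n\<close> outside \<open>X\<close>, go
      into \<open>Y\<close>; this yields both the missing edges and the sparsity.\<close>
    define X where "X = f ` {i. i < n \<and> (c i, c n) \<in> Erel C}"
    define Y where "Y = (f ` {..<n} \<union> b ` {..n}) - X"
    have fB: "f i \<in> verts B" "s (f i) = sC (c i)" if "i < n" for i
      using IH[OF that] by (auto simp: P_def)
    have YV: "Y \<subseteq> verts B" using fB b by (auto simp: Y_def bij_betw_def)
    have XV: "X \<subseteq> verts B" using fB by (auto simp: X_def)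
    have sX: "s x \<noteq> sC (c n)" if "x \<in> X" for x
      using that fB(2) CE(2) by (auto simp: X_def)
    have fin: "finite X" "finite Y" "X \<inter> Y = {}" by (auto simp: X_def Y_def)
    obtain r where r: "r \<in> verts B" "r \<notin> X" "r \<notin> Y" "s r = sC (c n)"
      "\<And>x. x \<in> X \<Longrightarrow> (x, r) \<in> Erel B" "\<And>y. y \<in> Y \<Longrightarrow> (y, r) \<notin> Erel B"
      using extension_propertyD[OF B(2) fin(1,2) XV YV fin(3) sX] by blast
    \<comment> \<open>Injectivity so far prevents a non-neighbour of \<open>c n\<close> from sharing
      its image with a neighbour.\<close>
    have fX: "f i \<in> X \<longleftrightarrow> (c i, c n) \<in> Erel C" if "i < n" for i
    proof
      assume "f i \<in> X"
      then obtain i' where "i' < n" "(c i', c n) \<in> Erel C" "f i = f i'" by (auto simp: X_def)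
      then show "(c i, c n) \<in> Erel C" using inj[of i i'] that by auto
    qed (use that in \<open>simp add: X_def\<close>)
    have fXY: "f i \<in> X \<or> f i \<in> Y" if "i < n" for i using that by (auto simp: Y_def)
    have bY: "b m \<in> Y" if "m \<le> n" "b m \<notin> f ` {..<n}" for m
      using that by (auto simp: Y_def X_def)
    have rb: "r \<notin> b ` {..n}"
      using r(2,3) by (auto simp: Y_def)
    have "P f n r"
      unfolding P_def
    proof (intro conjI allI impI)
      fix i assume i: "i < n"
      show "r \<noteq> f i" using fXY[OF i] r(2,3) by auto
      show "(f i, r) \<in> Erel B \<longleftrightarrow> (c i, c n) \<in> Erel C" using fX[OF i] fXY[OF i] r(5,6) by blast
    next
      fix m assume "m \<le> n" "b m \<notin> f ` {..<n}"
      then show "(b m, r) \<notin> Erel B" using bY r(6) by blast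
    qed (use r(1,4) rb in auto)
    then show "\<exists>r. P f n r" ..
  qed
  then obtain f where f: "\<And>n. P f n (f n)" by blast
  have inj: "f i \<noteq> f j" if "i \<noteq> j" for i j
    using that f[of i] f[of j] by (cases "i < j") (auto simp: P_def)
  have loop: "(f i, f i) \<notin> Erel B" "(c i, c i) \<notin> Erel C" for i
    using BE(2) CE(2) by blast+
  have lt: "(f i, f j) \<in> Erel B \<longleftrightarrow> (c i, c j) \<in> Erel C" if "i < j" for i j
    using f[of j] that by (auto simp: P_def)
  have edge: "(f i, f j) \<in> Erel B \<longleftrightarrow> (c i, c j) \<in> Erel C" for i j
    using lt[of i j] lt[of j i] loop[of i] BE(1) CE(1)
    by (metis linorder_less_linear symE)
  define d where "d = inv_into UNIV c"
  have d: "c (d v) = v" if "v \<in> verts C" for v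
    using c that by (auto simp: d_def bij_betw_def f_inv_into_f)
  have dc: "d (c i) = i" for i using c by (simp add: d_def bij_betw_def)
  define e where "e = f \<circ> d"
  have fin: "finite {u \<in> verts C. (e u, v) \<in> Erel B}" if "v \<in> verts B - e ` verts C" for v
  proof -
    have "v \<in> range b" using that b by (simp add: bij_betw_def)
    then obtain m where m: "v = b m" by (rule imageE)
    have nf: "f n \<noteq> b m" for n
    proof -
      have "f n = e (c n)" by (simp add: e_def dc)
      moreover have "c n \<in> verts C" using c by (auto simp: bij_betw_def)
      ultimately show ?thesis using that m by (metis DiffD2 imageI)
    qed
    have "u \<in> c ` {..<m}" if u: "u \<in> verts C" "(e u, v) \<in> Erel B" for u
    proof -
      have "d u < m"
      proof (rule ccontr)
        assume "\<not> d u < m"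
        then have "(b m, f (d u)) \<notin> Erel B"
          using f[of "d u"] nf unfolding P_def by (metis imageE linorder_not_less)
        then show False using u m BE(1) by (auto simp: e_def sym_def)
      qed
      then show ?thesis using d[OF u(1)] by (metis imageI lessThan_iff)
    qed
    then have "{u \<in> verts C. (e u, v) \<in> Erel B} \<subseteq> c ` {..<m}" by blast
    then show ?thesis by (rule finite_subset) simp
  qed
  show thesis
  proof (rule that[of e])
    show "inj_on e (verts C)"
      using inj d by (metis (no_types, lifting) comp_apply e_def inj_onI)
    show ed: "(e u, e v) \<in> Erel B \<longleftrightarrow> (u, v) \<in> Erel C" if "u \<in> verts C" "v \<in> verts C" for u v
      using that edge d by (simp add: e_def)
    show "side_hom C sC B s e"
      unfolding side_hom_def
    proof (intro conjI)
      show "e \<in> verts C \<rightarrow> verts B" using f by (auto simp: e_def P_def)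
      show "\<forall>u\<in>verts C. s (e u) = sC u" using f d unfolding e_def P_def by (metis comp_apply)
      show "\<forall>u v. (u, v) \<in> Erel C \<longrightarrow> (e u, e v) \<in> Erel B" using ed CE(3) by blast
    qed
  qed (rule fin)
qed

text \<open>Values are chosen along an enumeration of \<open>B\<close>. On the image of
  \<open>e\<close> they are dictated by \<open>g\<close>; off the image, sparsity leaves finitely
  many adjacency demands, which \<open>side_closed\<close> meets.\<close>

lemma extend_side_hom:
  fixes b :: "nat \<Rightarrow> 'b" and H :: "'d bstruct"
  assumes B: "sided B s" and H: "sided H t" "side_closed H t"
    and b: "bij_betw b UNIV (verts B)"
    and C: "sided C sC" and e: "side_hom C sC B s e" "inj_on e (verts C)"
    "\<And>u v. u \<in> verts C \<Longrightarrow> v \<in> verts C \<Longrightarrow> (e u, e v) \<in> Erel B \<longleftrightarrow> (u, v) \<in> Erel C"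
    "\<And>v. v \<in> verts B - e ` verts C \<Longrightarrow> finite {u \<in> verts C. (e u, v) \<in> Erel B}"
    and g: "side_hom C sC H t g"
  obtains k where "side_hom B s H t k" "\<And>u. u \<in> verts C \<Longrightarrow> k (e u) = g u"
proof -
  define I where "I = e ` verts C"
  define j where "j = inv_into (verts C) e"
  have j: "j v \<in> verts C" "e (j v) = v" if "v \<in> I" for v
    using that by (auto simp: I_def j_def inv_into_into f_inv_into_f)
  have je: "j (e u) = u" if "u \<in> verts C" for u
    using that e(2) by (simp add: j_def)
  have BE: "sym (Erel B)" "\<And>u v. (u, v) \<in> Erel B \<Longrightarrow> s u \<noteq> s v" "Erel B \<subseteq> verts B \<times> verts B"
    using B by (auto simp: sided_def)
  have HE: "sym (Erel H)" using H by (auto simp: sided_def)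
  have es: "s (e u) = sC u" "e u \<in> verts B" "t (g u) = sC u" "g u \<in> verts H" if "u \<in> verts C" for u
    using e(1) g that by (auto simp: side_hom_def)
  have bV: "b m \<in> verts B" for m using b by (auto simp: bij_betw_def)
  \<comment> \<open>The last clause looks ahead: values on the image are known in advance, so
    \<open>b m\<close> outside it must respect all its neighbours there, including those enumerated
    later.\<close>
  define P where "P f m r \<longleftrightarrow> r \<in> verts H \<and> t r = s (b m) \<and> (b m \<in> I \<longrightarrow> r = g (j (b m))) \<and>
     (b m \<notin> I \<longrightarrow> (\<forall>i<m. (b i, b m) \<in> Erel B \<longrightarrow> (f i, r) \<in> Erel H) \<and>
        (\<forall>u\<in>verts C. (e u, b m) \<in> Erel B \<longrightarrow> (g u, r) \<in> Erel H))" for f m r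
  have "\<exists>f. \<forall>n. P f n (f n)"
  proof (rule dependent_wellorder_choice)
    fix r and f g :: "nat \<Rightarrow> 'd" and x :: nat
    assume eq: "\<And>y. y < x \<Longrightarrow> f y = g y"
    then show "P f x r = P g x r" by (auto simp: P_def)
  next
    fix m :: nat and f :: "nat \<Rightarrow> 'd"
    assume IH: "\<And>y. y < m \<Longrightarrow> P f y (f y)"
    have fH: "f i \<in> verts H" "t (f i) = s (b i)" if "i < m" for i
      using IH[OF that] by (auto simp: P_def)
    show "\<exists>r. P f m r"
    proof (cases "b m \<in> I")
      case True
      then have "P f m (g (j (b m)))" using es[OF j(1)[OF True]] j(2)[OF True] by (simp add: P_def)
      then show ?thesis ..
    next
      case False
      define A where "A = f ` {i. i < m \<and> (b i, b m) \<in> Erel B} \<union> g ` {u \<in> verts C. (e u, b m) \<in> Erel B}"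
      have "finite A" using e(4)[of "b m"] False bV[of m] by (auto simp: A_def I_def)
      moreover have "A \<subseteq> verts H" using fH es by (auto simp: A_def)
      moreover have "t a \<noteq> s (b m)" if "a \<in> A" for a
        using that fH es BE(2) by (auto simp: A_def) metis+
      ultimately obtain r where "r \<in> verts H" "t r = s (b m)" "\<And>a. a \<in> A \<Longrightarrow> (a, r) \<in> Erel H"
        using side_closedD[OF H(2), of A "{}" "s (b m)"] by auto
      then have "P f m r" using False by (auto simp: P_def A_def)
      then show ?thesis ..
    qed
  qed
  then obtain f where f: "\<And>n. P f n (f n)" by blast
  define k where "k = f \<circ> inv_into UNIV b"
  have kb: "k (b i) = f i" for i using b by (simp add: k_def bij_betw_def)
  have kI: "k v = g (j v)" if "v \<in> I" "v \<in> verts B" for v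
  proof -
    obtain m where "v = b m" using \<open>v \<in> verts B\<close> b by (auto simp: bij_betw_def)
    then show ?thesis using f[of m] that kb by (simp add: P_def)
  qed
  \<comment> \<open>An edge is respected at its end \<open>b m\<close> outside the image if the
    value of the other end was known when \<open>f m\<close> was chosen: earlier in the enumeration,
    or dictated by \<open>g\<close>.\<close>
  have half: "(f i, f m) \<in> Erel H" if ed: "(b i, b m) \<in> Erel B" and m: "b m \<notin> I" and i: "i < m \<or> b i \<in> I" for i m
  proof (cases "b i \<in> I")
    case True
    then have "f i = g (j (b i))" using f[of i] by (simp add: P_def)
    then show ?thesis using f[of m] j[OF True] ed m unfolding P_def by metis
  next
    case False
    then show ?thesis using f[of m] i ed m unfolding P_def by metis
  qed
  have fE: "(f i, f m) \<in> Erel H" if ed: "(b i, b m) \<in> Erel B" for i m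
  proof (cases "b i \<in> I \<and> b m \<in> I")
    case True
    then have "(j (b i), j (b m)) \<in> Erel C" using e(3)[of "j (b i)" "j (b m)"] j ed by simp
    then have "(g (j (b i)), g (j (b m))) \<in> Erel H" using g by (auto simp: side_hom_def)
    then show ?thesis using True f[of i] f[of m] by (simp add: P_def)
  next
    case False
    have ed': "(b m, b i) \<in> Erel B" using ed BE(1) by (auto simp: sym_def)
    have "i \<noteq> m" using BE(2) ed by blast
    \<comment> \<open>Every edge not inside the image meets the premises of \<open>half\<close> in
      one orientation: from the earlier end to the later if both ends are outside, otherwise towards
      the outside end.\<close>
    then have "(b m \<notin> I \<and> (i < m \<or> b i \<in> I)) \<or> (b i \<notin> I \<and> (m < i \<or> b m \<in> I))"
      using False by auto
    then have "(f i, f m) \<in> Erel H \<or> (f m, f i) \<in> Erel H" using half ed ed' by metis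
    then show ?thesis using HE by (auto simp: sym_def)
  qed
  show thesis
  proof (rule that[of k])
    show "k (e u) = g u" if "u \<in> verts C" for u
      using kI[of "e u"] es je that by (auto simp: I_def)
    show "side_hom B s H t k"
      unfolding side_hom_def
    proof (intro conjI allI impI ballI)
      have onb: "\<exists>m. v = b m" if "v \<in> verts B" for v using that b by (auto simp: bij_betw_def)
      show "k \<in> verts B \<rightarrow> verts H" using onb f kb by (fastforce simp: P_def)
      show "t (k u) = s u" if "u \<in> verts B" for u using onb[OF that] f kb by (fastforce simp: P_def)
      show "(k u, k v) \<in> Erel H" if "(u, v) \<in> Erel B" for u v
        using that BE(3) onb[of u] onb[of v] fE kb by (metis SigmaD1 SigmaD2 subsetD)
    qed
  qed
qed

text \<open>One embedding serves all \<open>g\<close>, so a single copy of \<open>C\<close> supports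
  continuum many extensions to endomorphisms of \<open>B\<close>.\<close>

lemma extensible_embedding:
  assumes C: "sided C sC" "countable (verts C)" "infinite (verts C)"
    and B: "sided B s" "extension_property B s" "countable (verts B)"
  obtains e where "side_hom C sC B s e" "inj_on e (verts C)"
    "\<And>u v. u \<in> verts C \<Longrightarrow> v \<in> verts C \<Longrightarrow> (e u, e v) \<in> Erel B \<longleftrightarrow> (u, v) \<in> Erel C"
    "\<And>g. side_hom C sC B s g \<Longrightarrow> \<exists>k. side_hom B s B s k \<and> (\<forall>u\<in>verts C. k (e u) = g u)"
proof -
  have c: "bij_betw (from_nat_into (verts C)) UNIV (verts C)"
    using C by (simp add: bij_betw_from_nat_into)
  have cl: "side_closed B s" using extension_property_imp_side_closed[OF B(2)] .
  have b: "bij_betw (from_nat_into (verts B)) UNIV (verts B)"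
    using B side_closed_infinite[OF cl] by (simp add: bij_betw_from_nat_into)
  obtain e where e: "side_hom C sC B s e" "inj_on e (verts C)"
    "\<And>u v. u \<in> verts C \<Longrightarrow> v \<in> verts C \<Longrightarrow> (e u, e v) \<in> Erel B \<longleftrightarrow> (u, v) \<in> Erel C"
    "\<And>v. v \<in> verts B - e ` verts C \<Longrightarrow> finite {u \<in> verts C. (e u, v) \<in> Erel B}"
    using sparse_embedding[OF C(1) B(1,2) c b] by blast
  show thesis
    using that[OF e(1-3)] extend_side_hom[OF B(1) B(1) cl b C(1) e] by metis
qed

section \<open>Bijective homomorphisms by back-and-forth\<close>

text \<open>Compatibility is a condition on two pairs at a time, so it passes from the finite stages
  to the union of their chain.\<close>

lemma back_and_forth:
  fixes R :: "'a \<times> 'b \<Rightarrow> 'a \<times> 'b \<Rightarrow> bool"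
  assumes cA: "countable A" and cD: "countable D"
    and forward: "\<And>p a. \<lbrakk>finite p; p \<subseteq> A \<times> D; \<forall>x\<in>p. \<forall>y\<in>p. R x y; a \<in> A\<rbrakk> \<Longrightarrow>
      \<exists>d\<in>D. \<forall>x\<in>insert (a, d) p. \<forall>y\<in>insert (a, d) p. R x y"
    and backward: "\<And>p d. \<lbrakk>finite p; p \<subseteq> A \<times> D; \<forall>x\<in>p. \<forall>y\<in>p. R x y; d \<in> D\<rbrakk> \<Longrightarrow>
      \<exists>a\<in>A. \<forall>x\<in>insert (a, d) p. \<forall>y\<in>insert (a, d) p. R x y"
  obtains p where "p \<subseteq> A \<times> D" "\<And>x y. x \<in> p \<Longrightarrow> y \<in> p \<Longrightarrow> R x y" "fst ` p = A" "snd ` p = D"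
proof -
  define Q where "Q p \<longleftrightarrow> finite p \<and> p \<subseteq> A \<times> D \<and> (\<forall>x\<in>p. \<forall>y\<in>p. R x y)" for p
  have f: "\<exists>p'. Q p' \<and> p \<subseteq> p' \<and> (a \<in> A \<longrightarrow> a \<in> fst ` p')" if p: "Q p" for p a
  proof (cases "a \<in> A")
    case True
    then obtain d where "d \<in> D" "\<forall>x\<in>insert (a, d) p. \<forall>y\<in>insert (a, d) p. R x y"
      using forward[of p a] p unfolding Q_def by blast
    then have "Q (insert (a, d) p)" using p True by (simp add: Q_def)
    then show ?thesis by (intro exI[of _ "insert (a, d) p"]) auto
  qed (use p in blast)
  have b: "\<exists>p'. Q p' \<and> p \<subseteq> p' \<and> (d \<in> D \<longrightarrow> d \<in> snd ` p')" if p: "Q p" for p d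
  proof (cases "d \<in> D")
    case True
    then obtain a where "a \<in> A" "\<forall>x\<in>insert (a, d) p. \<forall>y\<in>insert (a, d) p. R x y"
      using backward[of p d] p unfolding Q_def by blast
    then have "Q (insert (a, d) p)" using p True by (simp add: Q_def)
    then show ?thesis by (intro exI[of _ "insert (a, d) p"]) auto
  qed (use p in blast)
  \<comment> \<open>Stage \<open>n\<close> serves the \<open>n\<close>-th elements of both sets. The
    membership guards cover an empty set, whose enumeration has arbitrary values.\<close>
  have "\<exists>P. \<forall>n. Q (P n) \<and> (P n \<subseteq> P (Suc n) \<and>
      (from_nat_into A n \<in> A \<longrightarrow> from_nat_into A n \<in> fst ` P (Suc n)) \<and>
      (from_nat_into D n \<in> D \<longrightarrow> from_nat_into D n \<in> snd ` P (Suc n)))"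
  proof (rule dependent_nat_choice)
    show "\<exists>p. Q p" by (rule exI[of _ "{}"]) (simp add: Q_def)
    fix p n assume "Q p"
    then obtain p' where p': "Q p'" "p \<subseteq> p'" "from_nat_into A n \<in> A \<longrightarrow> from_nat_into A n \<in> fst ` p'"
      using f by blast
    obtain p'' where p'': "Q p''" "p' \<subseteq> p''" "from_nat_into D n \<in> D \<longrightarrow> from_nat_into D n \<in> snd ` p''"
      using b[OF p'(1)] by blast
    show "\<exists>y. Q y \<and> p \<subseteq> y \<and> (from_nat_into A n \<in> A \<longrightarrow> from_nat_into A n \<in> fst ` y) \<and>
        (from_nat_into D n \<in> D \<longrightarrow> from_nat_into D n \<in> snd ` y)"
      using p' p'' by (intro exI[of _ p'']) blast
  qed
  then obtain P where P: "\<And>n. Q (P n)" "\<And>n. P n \<subseteq> P (Suc n)"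
    "\<And>n. from_nat_into A n \<in> A \<Longrightarrow> from_nat_into A n \<in> fst ` P (Suc n)"
    "\<And>n. from_nat_into D n \<in> D \<Longrightarrow> from_nat_into D n \<in> snd ` P (Suc n)"
    by blast
  have mono: "P m \<subseteq> P n" if "m \<le> n" for m n
    using P(2) that by (rule lift_Suc_mono_le)
  define p where "p = (\<Union>n. P n)"
  have sub: "p \<subseteq> A \<times> D" using P(1) by (force simp: p_def Q_def)
  show thesis
  proof (rule that[OF sub])
    fix x y assume "x \<in> p" "y \<in> p"
    then obtain m n where "x \<in> P m" "y \<in> P n" by (auto simp: p_def)
    then have "x \<in> P (max m n)" "y \<in> P (max m n)"
      using mono[of m "max m n"] mono[of n "max m n"] by auto
    then show "R x y" using P(1)[of "max m n"] by (simp add: Q_def)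
  next
    show "fst ` p = A"
    proof
      show "A \<subseteq> fst ` p"
      proof
        fix a assume a: "a \<in> A"
        then obtain n where "from_nat_into A n = a" using from_nat_into_surj[OF cA] by blast
        then have "a \<in> fst ` P (Suc n)" using P(3)[of n] a by simp
        then show "a \<in> fst ` p" by (auto simp: p_def)
      qed
    qed (use sub in auto)
    show "snd ` p = D"
    proof
      show "D \<subseteq> snd ` p"
      proof
        fix a assume a: "a \<in> D"
        then obtain n where "from_nat_into D n = a" using from_nat_into_surj[OF cD] by blast
        then have "a \<in> snd ` P (Suc n)" using P(4)[of n] a by simp
        then show "a \<in> snd ` p" by (auto simp: p_def)
      qed
    qed (use sub in auto)
  qed
qed

text \<open>Edges need only be preserved, not reflected. Going forth, \<open>side_closed\<close>
  supplies a fresh image adjacent to the images of all neighbours; going back, the extension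
  property supplies a preimage without edges to the current domain.\<close>

lemma bijective_side_hom:
  assumes B: "sided B s" "extension_property B s" "countable (verts B)"
    and G: "sided G t" "side_closed G t" "countable (verts G)"
  obtains \<phi> where "side_hom B s G t \<phi>" "bij_betw \<phi> (verts B) (verts G)"
proof -
  \<comment> \<open>The first clause makes a set of compatible pairs the graph of an injective
    partial function; the last asks for preservation of edges in one direction only.\<close>
  define R where "R x y \<longleftrightarrow> (fst x = fst y \<longleftrightarrow> snd x = snd y) \<and> s (fst x) = t (snd x) \<and>
     ((fst x, fst y) \<in> Erel B \<longrightarrow> (snd x, snd y) \<in> Erel G)" for x y
  have BE: "sym (Erel B)" "\<And>u v. (u, v) \<in> Erel B \<Longrightarrow> s u \<noteq> s v" "Erel B \<subseteq> verts B \<times> verts B"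
    using B(1) by (auto simp: sided_def)
  have GE: "sym (Erel G)" using G(1) by (auto simp: sided_def)
  \<comment> \<open>For a fresh pair only edges towards \<open>a\<close> need checking: symmetry
    gives the reverse ones, and there are no loops.\<close>
  have new: "\<forall>x\<in>insert (a, d) p. \<forall>y\<in>insert (a, d) p. R x y"
    if p: "\<forall>x\<in>p. \<forall>y\<in>p. R x y" and st: "s a = t d" and a: "a \<notin> fst ` p" and d: "d \<notin> snd ` p"
      and E: "\<And>x y. (x, y) \<in> p \<Longrightarrow> (x, a) \<in> Erel B \<Longrightarrow> (y, d) \<in> Erel G" for a d p
  proof (intro ballI)
    have loop: "(a, a) \<notin> Erel B" using BE(2) by blast
    have old: "R z (a, d)" "R (a, d) z" if z: "z \<in> p" for z
    proof -
      have ne: "fst z \<noteq> a" "snd z \<noteq> d" using z a d by auto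
      have sz: "s (fst z) = t (snd z)" using p z by (auto simp: R_def)
      have e: "(fst z, a) \<in> Erel B \<Longrightarrow> (snd z, d) \<in> Erel G" using E[of "fst z" "snd z"] z by simp
      then have "(a, fst z) \<in> Erel B \<Longrightarrow> (d, snd z) \<in> Erel G" using BE(1) GE by (meson symE)
      then show "R z (a, d)" "R (a, d) z" using ne sz e st by (auto simp: R_def)
    qed
    have self: "R (a, d) (a, d)" using st loop by (simp add: R_def)
    fix x y assume "x \<in> insert (a, d) p" "y \<in> insert (a, d) p"
    then show "R x y" using old self p by blast
  qed
  obtain p where p: "p \<subseteq> verts B \<times> verts G" "\<And>x y. x \<in> p \<Longrightarrow> y \<in> p \<Longrightarrow> R x y"
    "fst ` p = verts B" "snd ` p = verts G"
  proof (rule back_and_forth[OF B(3) G(3), of R])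
    fix p a
    assume p: "finite p" "p \<subseteq> verts B \<times> verts G" "\<forall>x\<in>p. \<forall>y\<in>p. R x y" and a: "a \<in> verts B"
    show "\<exists>d\<in>verts G. \<forall>x\<in>insert (a, d) p. \<forall>y\<in>insert (a, d) p. R x y"
    proof (cases "a \<in> fst ` p")
      case True
      then obtain d where d: "(a, d) \<in> p" by auto
      then have "insert (a, d) p = p" by blast
      moreover have "d \<in> verts G" using d p(2) by blast
      ultimately show ?thesis using p(3) by (intro bexI[of _ d]) simp_all
    next
      case False
      define A where "A = snd ` {z \<in> p. (fst z, a) \<in> Erel B}"
      have "t y \<noteq> s a" if "y \<in> A" for y
      proof -
        obtain z where "z \<in> p" "y = snd z" "(fst z, a) \<in> Erel B" using \<open>y \<in> A\<close> by (auto simp: A_def)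
        then show ?thesis using p(3) BE(2)[of "fst z" a] by (auto simp: R_def)
      qed
      moreover have "finite A" "finite (snd ` p)" "A \<subseteq> verts G" using p by (auto simp: A_def)
      ultimately obtain d where d: "d \<in> verts G" "d \<notin> snd ` p" "t d = s a"
        "\<And>y. y \<in> A \<Longrightarrow> (y, d) \<in> Erel G"
        using side_closedD[OF G(2), of A "snd ` p" "s a"] by blast
      have "(y, d) \<in> Erel G" if "(x, y) \<in> p" "(x, a) \<in> Erel B" for x y
        by (rule d(4)) (use that in \<open>force simp: A_def\<close>)
      then show ?thesis
        using new[OF p(3) d(3)[symmetric] False d(2)] d(1) by blast
    qed
  next
    fix p d
    assume p: "finite p" "p \<subseteq> verts B \<times> verts G" "\<forall>x\<in>p. \<forall>y\<in>p. R x y" and d: "d \<in> verts G"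
    show "\<exists>a\<in>verts B. \<forall>x\<in>insert (a, d) p. \<forall>y\<in>insert (a, d) p. R x y"
    proof (cases "d \<in> snd ` p")
      case True
      then obtain a where a: "(a, d) \<in> p" by auto
      then have "insert (a, d) p = p" by blast
      moreover have "a \<in> verts B" using a p(2) by blast
      ultimately show ?thesis using p(3) by (intro bexI[of _ a]) simp_all
    next
      case False
      have fp: "finite (fst ` p)" "fst ` p \<subseteq> verts B" using p by auto
      \<comment> \<open>With \<open>X\<close> empty and the whole current domain as
        \<open>Y\<close>, the edge condition for the new pair is vacuous.\<close>
      obtain a where a: "a \<in> verts B" "a \<notin> fst ` p" "s a = t d"
        "\<And>x. x \<in> fst ` p \<Longrightarrow> (x, a) \<notin> Erel B"
        by (rule extension_propertyD[OF B(2), of "{}" "fst ` p" "t d"]) (use fp in auto)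
      have "(y, d) \<in> Erel G" if "(x, y) \<in> p" "(x, a) \<in> Erel B" for x y
        using a(4)[of x] that by force
      then show ?thesis using new[OF p(3) a(3) a(2) False] a(1) by blast
    qed
  qed (rule that; blast)
  define \<phi> where "\<phi> x = (SOME y. (x, y) \<in> p)" for x
  have \<phi>: "(x, \<phi> x) \<in> p" if "x \<in> verts B" for x
  proof -
    have "\<exists>y. (x, y) \<in> p" using that p(3) by force
    then show ?thesis unfolding \<phi>_def by (rule someI_ex)
  qed
  have "inj_on \<phi> (verts B)"
  proof (rule inj_onI)
    fix x y assume "x \<in> verts B" "y \<in> verts B" "\<phi> x = \<phi> y"
    then show "x = y" using p(2)[OF \<phi> \<phi>, of x y] by (simp add: R_def)
  qed
  moreover have "\<phi> ` verts B = verts G"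
  proof
    show "\<phi> ` verts B \<subseteq> verts G" using \<phi> p(1) by blast
    show "verts G \<subseteq> \<phi> ` verts B"
    proof
      fix y assume "y \<in> verts G"
      then obtain x where x: "(x, y) \<in> p" using p(4) by force
      then have xB: "x \<in> verts B" using p(1) by blast
      then have "\<phi> x = y" using p(2)[OF \<phi>[OF xB] x] by (simp add: R_def)
      then show "y \<in> \<phi> ` verts B" using xB by blast
    qed
  qed
  moreover have "side_hom B s G t \<phi>"
    unfolding side_hom_def
  proof (intro conjI allI impI ballI)
    show "\<phi> \<in> verts B \<rightarrow> verts G" using \<phi> p(1) by blast
    show "t (\<phi> u) = s u" if "u \<in> verts B" for u
      using p(2)[OF \<phi>[OF that] \<phi>[OF that]] by (simp add: R_def)
    show "(\<phi> u, \<phi> v) \<in> Erel G" if "(u, v) \<in> Erel B" for u v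
    proof -
      have "u \<in> verts B" "v \<in> verts B" using that BE(3) by auto
      then show ?thesis using p(2)[OF \<phi> \<phi>, of u v] that by (simp add: R_def)
    qed
  qed
  ultimately show thesis using that by (simp add: bij_betw_def)
qed

lemma isomorphic_sym:
  assumes "structure_wf G" "structure_wf H" "isomorphic G H"
  shows "isomorphic H G"
proof -
  obtain f where "iso_on G H f" using assms(3) by (auto simp: isomorphic_def)
  then have b: "bij_betw f (verts G) (verts H)"
    and f: "\<And>u v. u \<in> verts G \<Longrightarrow> v \<in> verts G \<Longrightarrow> ((f u, f v) \<in> Erel H \<longleftrightarrow> (u, v) \<in> Erel G) \<and>
       ((f u, f v) \<in> Prel H \<longleftrightarrow> (u, v) \<in> Prel G)"
    using assms by (auto simp: iso_on_iff)
  define g where "g = inv_into (verts G) f"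
  have g: "g v \<in> verts G" "f (g v) = v" if "v \<in> verts H" for v
    using b that by (auto simp: g_def bij_betw_def inv_into_into f_inv_into_f)
  have "iso_on H G g"
    unfolding iso_on_iff[OF assms(2,1)]
  proof (intro conjI ballI)
    show "bij_betw g (verts H) (verts G)" unfolding g_def by (rule bij_betw_inv_into[OF b])
    fix u v assume uv: "u \<in> verts H" "v \<in> verts H"
    show "(g u, g v) \<in> Erel G \<longleftrightarrow> (u, v) \<in> Erel H" "(g u, g v) \<in> Prel G \<longleftrightarrow> (u, v) \<in> Prel H"
      using f[OF g(1)[OF uv(1)] g(1)[OF uv(2)]] g(2) uv by simp_all
  qed
  then show ?thesis by (auto simp: isomorphic_def)
qed

section \<open>Green's relations and cardinalities\<close>

text \<open>A principal left ideal contains its generator because of the identity and absorbs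
  multiplication from the left, so inclusion of ideals is divisibility of generators. The dual holds
  for \<open>green_R\<close>.\<close>

lemma green_L_iff:
  assumes "monoid M"
  shows "(f, g) \<in> green_L M \<longleftrightarrow> f \<in> carrier M \<and> g \<in> carrier M \<and>
    (\<exists>h\<in>carrier M. f = h \<otimes>\<^bsub>M\<^esub> g) \<and> (\<exists>h\<in>carrier M. g = h \<otimes>\<^bsub>M\<^esub> f)"
proof -
  interpret monoid M by fact
  have sub: "carrier M #>\<^bsub>M\<^esub> f \<subseteq> carrier M #>\<^bsub>M\<^esub> g \<longleftrightarrow> (\<exists>h\<in>carrier M. f = h \<otimes>\<^bsub>M\<^esub> g)"
    if fg: "f \<in> carrier M" "g \<in> carrier M" for f g
  proof
    have "\<one>\<^bsub>M\<^esub> \<otimes>\<^bsub>M\<^esub> f \<in> carrier M #>\<^bsub>M\<^esub> f" unfolding r_coset_def by blast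
    moreover assume "carrier M #>\<^bsub>M\<^esub> f \<subseteq> carrier M #>\<^bsub>M\<^esub> g"
    ultimately show "\<exists>h\<in>carrier M. f = h \<otimes>\<^bsub>M\<^esub> g" using fg unfolding r_coset_def by auto
  next
    assume "\<exists>h\<in>carrier M. f = h \<otimes>\<^bsub>M\<^esub> g"
    then obtain h where h: "h \<in> carrier M" "f = h \<otimes>\<^bsub>M\<^esub> g" by blast
    show "carrier M #>\<^bsub>M\<^esub> f \<subseteq> carrier M #>\<^bsub>M\<^esub> g"
    proof
      fix x assume "x \<in> carrier M #>\<^bsub>M\<^esub> f"
      then obtain k where k: "k \<in> carrier M" "x = k \<otimes>\<^bsub>M\<^esub> f" unfolding r_coset_def by blast
      then have "x = (k \<otimes>\<^bsub>M\<^esub> h) \<otimes>\<^bsub>M\<^esub> g" using h fg by (simp add: m_assoc)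
      then show "x \<in> carrier M #>\<^bsub>M\<^esub> g" using k h unfolding r_coset_def by blast
    qed
  qed
  show ?thesis using sub[of f g] sub[of g f] unfolding green_L_def by blast
qed

lemma green_R_iff:
  assumes "monoid M"
  shows "(f, g) \<in> green_R M \<longleftrightarrow> f \<in> carrier M \<and> g \<in> carrier M \<and>
    (\<exists>h\<in>carrier M. f = g \<otimes>\<^bsub>M\<^esub> h) \<and> (\<exists>h\<in>carrier M. g = f \<otimes>\<^bsub>M\<^esub> h)"
proof -
  interpret monoid M by fact
  have sub: "f <#\<^bsub>M\<^esub> carrier M \<subseteq> g <#\<^bsub>M\<^esub> carrier M \<longleftrightarrow> (\<exists>h\<in>carrier M. f = g \<otimes>\<^bsub>M\<^esub> h)"
    if fg: "f \<in> carrier M" "g \<in> carrier M" for f g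
  proof
    have "f \<otimes>\<^bsub>M\<^esub> \<one>\<^bsub>M\<^esub> \<in> f <#\<^bsub>M\<^esub> carrier M" unfolding l_coset_def by blast
    moreover assume "f <#\<^bsub>M\<^esub> carrier M \<subseteq> g <#\<^bsub>M\<^esub> carrier M"
    ultimately show "\<exists>h\<in>carrier M. f = g \<otimes>\<^bsub>M\<^esub> h" using fg unfolding l_coset_def by auto
  next
    assume "\<exists>h\<in>carrier M. f = g \<otimes>\<^bsub>M\<^esub> h"
    then obtain h where h: "h \<in> carrier M" "f = g \<otimes>\<^bsub>M\<^esub> h" by blast
    show "f <#\<^bsub>M\<^esub> carrier M \<subseteq> g <#\<^bsub>M\<^esub> carrier M"
    proof
      fix x assume "x \<in> f <#\<^bsub>M\<^esub> carrier M"
      then obtain k where k: "k \<in> carrier M" "x = f \<otimes>\<^bsub>M\<^esub> k" unfolding l_coset_def by blast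
      then have "x = g \<otimes>\<^bsub>M\<^esub> (h \<otimes>\<^bsub>M\<^esub> k)" using h fg by (simp add: m_assoc)
      then show "x \<in> g <#\<^bsub>M\<^esub> carrier M" using k h unfolding l_coset_def by blast
    qed
  qed
  show ?thesis using sub[of f g] sub[of g f] unfolding green_R_def by blast
qed

lemma green_L_refl: "f \<in> carrier M \<Longrightarrow> (f, f) \<in> green_L M"
  by (simp add: green_L_def)

lemma green_R_refl: "f \<in> carrier M \<Longrightarrow> (f, f) \<in> green_R M"
  by (simp add: green_R_def)

lemma green_D_subset_carrier: "green_D M `` {f} \<subseteq> carrier M"
  by (auto simp: green_D_def green_R_def)

text \<open>There are at most as many classes as elements of \<open>X\<close>. Conversely, if the
  classes of \<open>F S\<close> and \<open>F T\<close> coincide, reflexivity at \<open>F T\<close>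
  puts it into the class of \<open>F S\<close>, and then \<open>S = T\<close>.\<close>

lemma quotient_eqpoll_continuum:
  fixes F :: "nat set \<Rightarrow> 'x"
  assumes "X \<lesssim> (UNIV :: nat set set)" "\<And>S. F S \<in> X" "\<And>S. (F S, F S) \<in> r"
    "\<And>S T. (F S, F T) \<in> r \<Longrightarrow> S = T"
  shows "X // r \<approx> (UNIV :: nat set set)"
proof (rule lepoll_antisym)
  have "X // r = (\<lambda>x. r `` {x}) ` X" by (auto simp: quotient_def)
  then have "X // r \<lesssim> X" by (simp add: image_lepoll)
  then show "X // r \<lesssim> (UNIV :: nat set set)" using assms(1) lepoll_trans by blast
  have "inj (\<lambda>S. r `` {F S})"
  proof (rule injI)
    fix S T assume "r `` {F S} = r `` {F T}"
    then have "(F S, F T) \<in> r" using assms(3)[of T] by blast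
    then show "S = T" by (rule assms(4))
  qed
  moreover have "range (\<lambda>S. r `` {F S}) \<subseteq> X // r"
    using assms(2) by (auto simp: quotient_def)
  ultimately show "(UNIV :: nat set set) \<lesssim> X // r" unfolding lepoll_def by blast
qed

text \<open>An endomorphism is coded by its graph, a set of encoded pairs of naturals;
  extensionality leaves no freedom off the vertices.\<close>

lemma End_monoid_lepoll_continuum:
  assumes "countable (verts G)"
  shows "carrier (End_monoid G) \<lesssim> (UNIV :: nat set set)"
proof -
  define c where "c = to_nat_on (verts G)"
  have c: "c x = c y \<longleftrightarrow> x = y" if "x \<in> verts G" "y \<in> verts G" for x y
    using assms that by (simp add: c_def)
  define F where "F f = (\<lambda>x. prod_encode (c x, c (f x))) ` verts G" for f
  have "inj_on F (carrier (End_monoid G))"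
  proof (rule inj_onI)
    fix f g assume f: "f \<in> carrier (End_monoid G)" and g: "g \<in> carrier (End_monoid G)" and eq: "F f = F g"
    show "f = g"
    proof (rule extensionalityI)
      show "f \<in> extensional (verts G)" "g \<in> extensional (verts G)" using f g by (auto simp: End_monoid_def)
      fix x assume x: "x \<in> verts G"
      then have "prod_encode (c x, c (f x)) \<in> F g" unfolding eq[symmetric] by (simp add: F_def)
      then obtain y where y: "y \<in> verts G" "c x = c y" "c (f x) = c (g y)" by (auto simp: F_def)
      moreover have "f x \<in> verts G" "g y \<in> verts G"
        using f g x y(1) by (auto simp: End_monoid_def hom_on_def)
      ultimately show "f x = g x" using c x by simp
    qed
  qed
  then show ?thesis unfolding lepoll_def by blast
qed

lemma restrict_side_hom_in_End:
  assumes "sided B s" "side_hom B s B s f"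
  shows "restrict f (verts B) \<in> carrier (End_monoid B)"
proof -
  have "side_hom B s B s (restrict f (verts B))"
    using assms unfolding side_hom_def sided_def by (auto simp: subset_iff)
  then show ?thesis
    using side_hom_imp_hom_on[OF assms(1) assms(1)] by (simp add: End_monoid_def)
qed

lemma End_mult_apply: "x \<in> verts B \<Longrightarrow> (f \<otimes>\<^bsub>End_monoid B\<^esub> g) x = f (g x)"
  by (simp add: End_monoid_def compose_eq)

lemma End_eqI:
  assumes "f \<in> carrier (End_monoid B)" "g \<in> carrier (End_monoid B)" "\<And>x. x \<in> verts B \<Longrightarrow> f x = g x"
  shows "f = g"
  using assms by (intro extensionalityI[of f "verts B" g]) (auto simp: End_monoid_def)

lemma End_apply_closed: "f \<in> carrier (End_monoid B) \<Longrightarrow> x \<in> verts B \<Longrightarrow> f x \<in> verts B"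
  by (auto simp: End_monoid_def hom_on_def)

definition sided_graph :: "'a set \<Rightarrow> ('a \<times> 'a) set \<Rightarrow> ('a \<Rightarrow> bool) \<Rightarrow> 'a bstruct" where
  "sided_graph V E s = \<lparr>verts = V, Erel = E, Prel = {(u, v). u \<in> V \<and> v \<in> V \<and> s u = s v}\<rparr>"

lemma sided_graph_simps [simp]: "verts (sided_graph V E s) = V" "Erel (sided_graph V E s) = E"
  by (simp_all add: sided_graph_def)

lemma sided_sided_graph:
  assumes "E \<subseteq> V \<times> V" "sym E" "\<And>u v. (u, v) \<in> E \<Longrightarrow> s u \<noteq> s v"
  shows "sided (sided_graph V E s) s"
  using assms by (auto simp: sided_def sided_graph_def)

theorem theorem5p8:
  fixes B :: "'b bstruct" and \<Gamma> :: "'a bstruct"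
  assumes "universal_bipartite_graph B"
    and "bipartite_graph \<Gamma>"
    and "countable (verts \<Gamma>)"
    and "strongly_algebraically_closed \<Gamma>"
    and "\<not> isomorphic \<Gamma> B"
  shows "\<exists>f \<in> carrier (End_monoid B).
    \<not> regular_element (End_monoid B) f \<and>
    inj_on f (verts B) \<and>
    isomorphic (induced B (f ` verts B)) \<Gamma> \<and>
    (green_D (End_monoid B) `` {f}) // green_R (End_monoid B) \<approx> (UNIV :: nat set set) \<and>
    (green_D (End_monoid B) `` {f}) // green_L (End_monoid B) \<approx> (UNIV :: nat set set)"
proof -
  let ?M = "End_monoid B" and ?V = "verts B"
  obtain s where s: "sided B s"
    using assms(1) unfolding universal_bipartite_graph_def bipartite_graph_iff_sided by blast
  obtain t where t: "sided \<Gamma> t" using assms(2) unfolding bipartite_graph_iff_sided by blast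
  have cB: "countable ?V"
    using assms(1) by (simp add: universal_bipartite_graph_def Fraisse_limit_def)
  have ext: "extension_property B s" by (rule universal_extension_property[OF assms(1) s])
  have clB: "side_closed B s" by (rule extension_property_imp_side_closed[OF ext])
  have clG: "side_closed \<Gamma> t" by (rule strongly_algebraically_closed_imp_side_closed[OF t assms(4)])
  interpret M: monoid ?M by (rule monoid_End_monoid[OF sided_structure_wf[OF s]])
  note Liff = green_L_iff[OF M.monoid_axioms] and Riff = green_R_iff[OF M.monoid_axioms]
  have wfB: "structure_wf B" and wfG: "structure_wf \<Gamma>"
    using s t by (auto intro: sided_structure_wf)
  have tE: "Erel \<Gamma> \<subseteq> verts \<Gamma> \<times> verts \<Gamma>" "sym (Erel \<Gamma>)" "\<And>u v. (u, v) \<in> Erel \<Gamma> \<Longrightarrow> t u \<noteq> t v"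
    "Prel \<Gamma> = {(u, v). u \<in> verts \<Gamma> \<and> v \<in> verts \<Gamma> \<and> t u = t v}"
    using t by (auto simp: sided_def)
  have sE: "Erel B \<subseteq> ?V \<times> ?V" "sym (Erel B)" "\<And>u v. (u, v) \<in> Erel B \<Longrightarrow> s u \<noteq> s v"
    "Prel B = {(u, v). u \<in> ?V \<and> v \<in> ?V \<and> s u = s v}"
    using s by (auto simp: sided_def)

  \<comment> \<open>The bijective homomorphism from \<open>B\<close> onto \<Gamma>\<close>
  obtain \<phi> where \<phi>: "side_hom B s \<Gamma> t \<phi>" "bij_betw \<phi> ?V (verts \<Gamma>)"
    using bijective_side_hom[OF s ext cB t clG assms(3)] by blast
  have \<phi>V: "\<phi> x \<in> verts \<Gamma>" "t (\<phi> x) = s x" if "x \<in> ?V" for x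
    using \<phi>(1) that by (auto simp: side_hom_def)

  \<comment> \<open>Copies of \<Gamma> selected from a doubled \<Gamma> inside
    \<open>B\<close>\<close>
  define \<Gamma>2 where "\<Gamma>2 = sided_graph (verts \<Gamma> \<times> (UNIV :: bool set))
    {(x, y). (fst x, fst y) \<in> Erel \<Gamma>} (t \<circ> fst)"
  have s2: "sided \<Gamma>2 (t \<circ> fst)"
    unfolding \<Gamma>2_def
  proof (rule sided_sided_graph)
    show "sym {(x :: 'a \<times> bool, y :: 'a \<times> bool). (fst x, fst y) \<in> Erel \<Gamma>}"
      using tE(2) by (auto simp: sym_def)
  qed (use tE(1,3) in auto)
  have "countable (verts \<Gamma>2)" "infinite (verts \<Gamma>2)"
    using assms(3) side_closed_infinite[OF clG] by (auto simp: \<Gamma>2_def finite_cartesian_product_iff)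
  then obtain e where e: "side_hom \<Gamma>2 (t \<circ> fst) B s e" "inj_on e (verts \<Gamma>2)"
    "\<And>u v. u \<in> verts \<Gamma>2 \<Longrightarrow> v \<in> verts \<Gamma>2 \<Longrightarrow> (e u, e v) \<in> Erel B \<longleftrightarrow> (u, v) \<in> Erel \<Gamma>2"
    "\<And>g. side_hom \<Gamma>2 (t \<circ> fst) B s g \<Longrightarrow> \<exists>k. side_hom B s B s k \<and> (\<forall>u\<in>verts \<Gamma>2. k (e u) = g u)"
    using extensible_embedding[OF s2 _ _ s ext cB] by blast
  define c where "c = from_nat_into (verts \<Gamma>)"
  have c: "bij_betw c UNIV (verts \<Gamma>)"
    using assms(3) side_closed_infinite[OF clG] by (simp add: c_def bij_betw_from_nat_into)
  have cc: "c i = c j \<longleftrightarrow> i = j" "c i \<in> verts \<Gamma>" for i j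
    using c by (auto simp: bij_betw_def inj_eq)
  \<comment> \<open>The set \<open>S\<close> of indices selects the twin tagged \<open>True\<close>
    at the vertices \<open>c n\<close> with \<open>n\<close> in \<open>S\<close>, and the twin
    tagged \<open>False\<close> elsewhere.\<close>
  define \<psi> where "\<psi> S v = e (v, v \<in> c ` S)" for S v
  have \<psi>V: "\<psi> S v \<in> ?V" "s (\<psi> S v) = t v" if "v \<in> verts \<Gamma>" for S v
    using e(1) that by (auto simp: \<psi>_def side_hom_def \<Gamma>2_def)
  have \<psi>E: "(\<psi> S u, \<psi> S v) \<in> Erel B \<longleftrightarrow> (u, v) \<in> Erel \<Gamma>"
    if "u \<in> verts \<Gamma>" "v \<in> verts \<Gamma>" for S u v
    using e(3)[of "(u, u \<in> c ` S)" "(v, v \<in> c ` S)"] that by (simp add: \<psi>_def \<Gamma>2_def)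
  have \<psi>eq: "\<psi> S u = \<psi> T v \<longleftrightarrow> u = v \<and> (u \<in> c ` S \<longleftrightarrow> v \<in> c ` T)"
    if "u \<in> verts \<Gamma>" "v \<in> verts \<Gamma>" for S T u v
    using inj_on_eq_iff[OF e(2), of "(u, u \<in> c ` S)" "(v, v \<in> c ` T)"] that by (simp add: \<psi>_def \<Gamma>2_def)
  have \<psi>hom: "side_hom \<Gamma> t B s (\<psi> S)" for S
    unfolding side_hom_def using \<psi>V \<psi>E tE(1) by blast
  define F where "F S = restrict (\<psi> S \<circ> \<phi>) ?V" for S
  have F: "F S \<in> carrier ?M" for S
    unfolding F_def by (intro restrict_side_hom_in_End[OF s] side_hom_comp[OF \<phi>(1) \<psi>hom])
  have Fap: "F S x = \<psi> S (\<phi> x)" if "x \<in> ?V" for S x using that by (simp add: F_def)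
  have Fimg: "F S ` ?V = \<psi> S ` verts \<Gamma>" for S
    unfolding F_def image_restrict_eq image_comp[symmetric] using \<phi>(2) by (simp add: bij_betw_def)
  have Finj: "inj_on (F S) ?V" for S
  proof (rule inj_onI)
    fix x y assume xy: "x \<in> ?V" "y \<in> ?V" "F S x = F S y"
    then have "\<phi> x = \<phi> y" using \<psi>eq \<phi>V Fap by simp
    then show "x = y" using \<phi>(2) xy by (auto simp: bij_betw_def inj_on_def)
  qed

  \<comment> \<open>The maps \<open>F S\<close>: all \<open>\<L>\<close>-related, pairwise not
    \<open>\<R>\<close>-related\<close>
  have FK: "\<exists>K\<in>carrier ?M. F T = K \<otimes>\<^bsub>?M\<^esub> F S" for S T
  proof -
    \<comment> \<open>The projection \<open>fst\<close> forgets which twin was selected and \<psi>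
      reselects according to \<open>T\<close>; the extension to \<open>B\<close> is the left
      multiplier, whatever \<open>S\<close> is.\<close>
    have "side_hom \<Gamma>2 (t \<circ> fst) \<Gamma> t fst" by (auto simp: side_hom_def \<Gamma>2_def)
    then have "side_hom \<Gamma>2 (t \<circ> fst) B s (\<psi> T \<circ> fst)" by (rule side_hom_comp[OF _ \<psi>hom])
    then obtain k where k: "side_hom B s B s k" "\<And>u. u \<in> verts \<Gamma>2 \<Longrightarrow> k (e u) = \<psi> T (fst u)"
      using e(4) by fastforce
    have K: "restrict k ?V \<in> carrier ?M" by (rule restrict_side_hom_in_End[OF s k(1)])
    have "F T = restrict k ?V \<otimes>\<^bsub>?M\<^esub> F S"
    proof (rule End_eqI[OF F M.m_closed[OF K F]])
      fix x assume x: "x \<in> ?V"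
      then have "k (\<psi> S (\<phi> x)) = \<psi> T (\<phi> x)"
        using k(2)[of "(\<phi> x, \<phi> x \<in> c ` S)"] \<phi>V by (simp add: \<psi>_def \<Gamma>2_def)
      then show "F T x = (restrict k ?V \<otimes>\<^bsub>?M\<^esub> F S) x"
        using x by (simp add: End_mult_apply Fap \<psi>V \<phi>V)
    qed
    then show ?thesis using K by blast
  qed
  have FL: "(F S, F T) \<in> green_L ?M" for S T
    unfolding Liff using F FK by blast
  have FR: "S = T" if "(F S, F T) \<in> green_R ?M" for S T
  proof -
    \<comment> \<open>The factorization puts the image of \<open>F S\<close> inside that of
      \<open>F T\<close>. Then the twin of \<open>c n\<close> selected by \<open>S\<close> is also
      selected by \<open>T\<close>, which settles \<open>n\<close> in both directions.\<close>
    have sub: "n \<in> T \<longleftrightarrow> n \<in> S" if h: "h \<in> carrier ?M" "F S = F T \<otimes>\<^bsub>?M\<^esub> h" for S T h n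
    proof -
      have "\<psi> S (c n) \<in> F S ` ?V" unfolding Fimg using cc by blast
      then obtain x where x: "x \<in> ?V" "\<psi> S (c n) = F S x" by blast
      then have "\<psi> S (c n) = F T (h x)" using h(2) by (simp add: End_mult_apply)
      moreover have "h x \<in> ?V" using h(1) x(1) by (rule End_apply_closed)
      ultimately have "\<psi> S (c n) \<in> \<psi> T ` verts \<Gamma>" unfolding Fimg[symmetric] by blast
      then obtain v where "v \<in> verts \<Gamma>" "\<psi> S (c n) = \<psi> T v" by blast
      then have "c n \<in> c ` S \<longleftrightarrow> c n \<in> c ` T" using \<psi>eq[of "c n" v S T] cc(2) by blast
      then show ?thesis using cc(1) by auto
    qed
    show ?thesis using that sub unfolding Riff by blast
  qed

  \<comment> \<open>The map \<open>f\<close>, its image and its non-regularity\<close>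
  define f where "f = F {}"
  have fM: "f \<in> carrier ?M" and finj: "inj_on f ?V" using F Finj by (auto simp: f_def)
  have iso: "isomorphic (induced B (f ` ?V)) \<Gamma>"
  proof (rule isomorphic_sym[OF wfG structure_wf_induced])
    have "iso_on \<Gamma> (induced B (f ` ?V)) (\<psi> {})"
      unfolding iso_on_iff[OF wfG structure_wf_induced]
    proof (intro conjI ballI)
      show "bij_betw (\<psi> {}) (verts \<Gamma>) (verts (induced B (f ` ?V)))"
        using \<psi>eq by (auto simp: bij_betw_def f_def Fimg inj_on_def)
      fix u v assume uv: "u \<in> verts \<Gamma>" "v \<in> verts \<Gamma>"
      then show "(\<psi> {} u, \<psi> {} v) \<in> Erel (induced B (f ` ?V)) \<longleftrightarrow> (u, v) \<in> Erel \<Gamma>"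
        using \<psi>E by (simp add: f_def Fimg)
      show "(\<psi> {} u, \<psi> {} v) \<in> Prel (induced B (f ` ?V)) \<longleftrightarrow> (u, v) \<in> Prel \<Gamma>"
        using uv \<psi>V by (simp add: f_def Fimg sE(4) tE(4))
    qed
    then show "isomorphic \<Gamma> (induced B (f ` ?V))" by (auto simp: isomorphic_def)
  qed
  have nonreg: "\<not> regular_element ?M f"
  proof
    assume "regular_element ?M f"
    then obtain g where g: "g \<in> carrier ?M" "f \<otimes>\<^bsub>?M\<^esub> g \<otimes>\<^bsub>?M\<^esub> f = f" by (auto simp: regular_element_def)
    \<comment> \<open>Injectivity cancels the outer \<open>f\<close> in
      \<open>f g f = f\<close>.\<close>
    have gf: "g (f x) = x" if x: "x \<in> ?V" for x
    proof -
      have fx: "f x \<in> ?V" by (rule End_apply_closed[OF fM x])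
      have "f (g (f x)) = f x"
        using fun_cong[OF g(2), of x] x fx by (simp add: End_mult_apply)
      then show ?thesis using finj x End_apply_closed[OF g(1) fx] by (auto dest: inj_onD)
    qed
    \<comment> \<open>An edge between images under \<phi> is carried by \<psi> to an edge of
      \<open>B\<close>, and \<open>g\<close> brings it back to the original vertices. The
      endomorphism \<open>g\<close> might swap the sides, but only its preservation of edges enters;
      \<open>Prel\<close> is reflected because \<phi> preserves sides.\<close>
    have "iso_on B \<Gamma> \<phi>"
      unfolding iso_on_iff[OF wfB wfG]
    proof (intro conjI ballI)
      fix x y assume xy: "x \<in> ?V" "y \<in> ?V"
      show "(\<phi> x, \<phi> y) \<in> Erel \<Gamma> \<longleftrightarrow> (x, y) \<in> Erel B"
      proof
        assume "(\<phi> x, \<phi> y) \<in> Erel \<Gamma>"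
        then have "(f x, f y) \<in> Erel B" using \<psi>E \<phi>V xy by (simp add: f_def Fap)
        then have "(g (f x), g (f y)) \<in> Erel B" using g(1) by (auto simp: End_monoid_def hom_on_def)
        then show "(x, y) \<in> Erel B" using gf xy by simp
      qed (use \<phi>(1) in \<open>auto simp: side_hom_def\<close>)
      show "(\<phi> x, \<phi> y) \<in> Prel \<Gamma> \<longleftrightarrow> (x, y) \<in> Prel B" using xy \<phi>V by (simp add: sE(4) tE(4))
    qed (rule \<phi>(2))
    then have "isomorphic B \<Gamma>" by (auto simp: isomorphic_def)
    then show False using isomorphic_sym[OF wfB wfG] assms(5) by blast
  qed

  \<comment> \<open>Split surjections of \<open>B\<close> with prescribed kernels\<close>
  define sW where "sW = case_sum s (\<lambda>_ :: nat. True)"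
  define BW where "BW = sided_graph (Inl ` ?V \<union> range (Inr :: nat \<Rightarrow> 'b + nat))
    (map_prod Inl Inl ` Erel B) sW"
  have sBW: "sided BW sW"
    unfolding BW_def
  proof (rule sided_sided_graph)
    show "sym (map_prod Inl Inl ` Erel B :: (('b + nat) \<times> ('b + nat)) set)"
      by (rule symI) (use sE(2) in \<open>auto dest: symD\<close>)
  qed (use sE(1,3) in \<open>auto simp: sW_def\<close>)
  have "countable (verts BW)" using cB by (simp add: BW_def)
  moreover have "infinite (verts BW)"
    unfolding BW_def sided_graph_simps finite_Un by (simp add: finite_image_iff)
  ultimately obtain d where d: "side_hom BW sW B s d"
    "\<And>g. side_hom BW sW B s g \<Longrightarrow> \<exists>k. side_hom B s B s k \<and> (\<forall>u\<in>verts BW. k (d u) = g u)"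
    using extensible_embedding[OF sBW _ _ s ext cB] by metis
  \<comment> \<open>The isolated vertices \<open>Inr n\<close> all lie on the side
    \<open>True\<close>; two distinct targets on that side make every \<gamma> respect
    sides.\<close>
  obtain b0 where b0: "b0 \<in> ?V" "s b0"
    using side_closedD[OF clB, of "{}" "{}" True] by auto
  obtain b1 where b1: "b1 \<in> ?V" "s b1" "b1 \<noteq> b0"
    using side_closedD[OF clB, of "{}" "{b0}" True] by auto
  define \<gamma> where "\<gamma> S = case_sum id (\<lambda>n :: nat. if n \<in> S then b0 else b1)" for S
  have "side_hom BW sW B s (\<gamma> S)" for S
    unfolding side_hom_def using b0 b1 by (auto simp: BW_def \<gamma>_def sW_def)
  then have "\<forall>S. \<exists>k. side_hom B s B s k \<and> (\<forall>u\<in>verts BW. k (d u) = \<gamma> S u)" using d(2) by blast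
  then obtain k where k: "\<And>S. side_hom B s B s (k S)" "\<And>S u. u \<in> verts BW \<Longrightarrow> k S (d u) = \<gamma> S u"
    by metis
  have dV: "d u \<in> ?V" if "u \<in> verts BW" for u using d(1) that by (auto simp: side_hom_def)
  have VW: "Inr n \<in> verts BW" "Inl x \<in> verts BW \<longleftrightarrow> x \<in> ?V" for n x by (auto simp: BW_def)
  define K where "K S = restrict (k S) ?V" for S
  have K: "K S \<in> carrier ?M" for S unfolding K_def by (rule restrict_side_hom_in_End[OF s k(1)])
  have Kd: "K S (d u) = \<gamma> S u" if "u \<in> verts BW" for S u using that dV k(2) by (simp add: K_def)
  \<comment> \<open>Since every \<gamma> fixes the summand \<open>B\<close>, the map
    \<open>d \<circ> Inl\<close> is a right inverse of all the \<open>K S\<close> at once; hence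
    \<open>f\<close> is recovered from each \<open>H S\<close>.\<close>
  have "side_hom B s BW sW Inl" by (auto simp: side_hom_def BW_def sW_def)
  then have h: "restrict (d \<circ> Inl) ?V \<in> carrier ?M"
    by (intro restrict_side_hom_in_End[OF s] side_hom_comp[OF _ d(1)])
  define H where "H S = f \<otimes>\<^bsub>?M\<^esub> K S" for S
  have H: "H S \<in> carrier ?M" for S using fM K by (simp add: H_def)
  have Hd: "H S (d u) = f (\<gamma> S u)" if "u \<in> verts BW" for S u
    using that dV Kd by (simp add: H_def End_mult_apply)
  have fH: "f = H S \<otimes>\<^bsub>?M\<^esub> restrict (d \<circ> Inl) ?V" for S
  proof (rule End_eqI[OF fM M.m_closed[OF H h]])
    fix x assume x: "x \<in> ?V"
    then show "f x = (H S \<otimes>\<^bsub>?M\<^esub> restrict (d \<circ> Inl) ?V) x"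
      using Hd[of "Inl x" S] VW by (simp add: End_mult_apply \<gamma>_def)
  qed
  have HR: "(f, H S) \<in> green_R ?M" for S
    unfolding Riff using fM H fH h K by (metis H_def)
  have HL: "S = T" if "(H S, H T) \<in> green_L ?M" for S T
  proof -
    \<comment> \<open>Left multiplication can only enlarge the kernel, and \<open>H S\<close>
      identifies \<open>d (Inr n)\<close> with \<open>d (Inl b0)\<close> exactly if \<open>n\<close>
      is in \<open>S\<close>. Multipliers in both directions give \<open>S = T\<close>.\<close>
    have sub: "S \<subseteq> T" if g: "g \<in> carrier ?M" "H T = g \<otimes>\<^bsub>?M\<^esub> H S" for S T g
    proof
      fix n assume "n \<in> S"
      then have "H S (d (Inr n)) = H S (d (Inl b0))"
        using Hd VW b0 by (simp add: \<gamma>_def)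
      then have "H T (d (Inr n)) = H T (d (Inl b0))"
        using g(2) dV VW b0 by (simp add: End_mult_apply)
      then have "f (\<gamma> T (Inr n)) = f b0"
        using Hd VW b0 by (simp add: \<gamma>_def)
      moreover have "\<gamma> T (Inr n) \<in> ?V" using b0 b1 by (simp add: \<gamma>_def)
      ultimately have "\<gamma> T (Inr n) = b0" using finj b0 by (auto dest: inj_onD)
      then show "n \<in> T" using b1 by (auto simp: \<gamma>_def split: if_splits)
    qed
    show ?thesis using that sub unfolding Liff by blast
  qed

  \<comment> \<open>Counting the classes in the \<open>\<D>\<close>-class of
    \<open>f\<close>\<close>
  have D: "green_D ?M `` {f} \<lesssim> (UNIV :: nat set set)"
    using subset_imp_lepoll[OF green_D_subset_carrier] End_monoid_lepoll_continuum[OF cB]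
    by (rule lepoll_trans)
  have "(green_D ?M `` {f}) // green_R ?M \<approx> (UNIV :: nat set set)"
  proof (rule quotient_eqpoll_continuum[OF D, of F])
    \<comment> \<open>As \<open>green_D\<close> is the composite of \<open>green_L\<close> and
      \<open>green_R\<close>, the \<open>\<L>\<close>-class of \<open>f\<close> provides different
      \<open>\<R>\<close>-classes here, and its \<open>\<R>\<close>-class provides the different
      \<open>\<L>\<close>-classes below.\<close>
    show "F S \<in> green_D ?M `` {f}" for S
      using FL[of "{}" S] green_R_refl[OF F] by (auto simp: green_D_def f_def)
  qed (use F FR in \<open>auto intro: green_R_refl\<close>)
  moreover have "(green_D ?M `` {f}) // green_L ?M \<approx> (UNIV :: nat set set)"
  proof (rule quotient_eqpoll_continuum[OF D, of H])
    show "H S \<in> green_D ?M `` {f}" for S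
      using HR green_L_refl[OF fM] by (auto simp: green_D_def)
  qed (use H HL in \<open>auto intro: green_L_refl\<close>)
  ultimately show ?thesis using fM nonreg finj iso by blast
qed

end
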